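(* Let $C$ be an analytic reduced plane curve defined by $f=\prod_{i\in I}f_i\in\mathbb{C}\{X,Y\}$, $I=\{1,\ldots,r\}$, $r>1$, with $f_i$ irreducible and $\langle f_i\rangle\neq\langle f_j\rangle$ for $i\neq j$, and let $C_i$ be the branch defined by $f_i$. Let $\Delta_i=\nu_i(\mathcal{J}(f)_i)$ for $i\in I$. Then $$\tau(C)=\sum_{i\in I}\tau(C_i)+\sum_{1\leq i<j\leq r}\mathrm{I}(f_i,f_j)+\sum_{i=2}^r\sharp\left(\Delta_i\setminus\nu_i\left(\mathcal{N}_{[1,i)}(\mathcal{J}(f))\right)\right).$$
   Context: $\mathcal{O}=\mathbb{C}\{X,Y\}/\langle f\rangle$ and $\mathcal{O}_i=\mathbb{C}\{X,Y\}/\langle f_i\rangle$. The normalization of $\mathcal{O}_i$ is identified with a one-variable power series ring in $t_i$, with fraction field $\mathcal{K}_i$, and $\mathcal{O}\subset\prod_{i\in I}\mathcal{O}_i\subset\mathcal{K}=\prod_{i\in I}\mathcal{K}_i$, the total ring of fractions of $\mathcal{O}$; $\pi_i:\mathcal{K}\to\mathcal{K}_i$ is the projection. $\nu_i$ is the $t_i$-adic order on $\mathcal{K}_i$ (with $\nu_i(0)=\infty$), and $\nu_i(z):=\nu_i(\pi_i(z))$ for $z\in\mathcal{K}$. The Jacobian ideal of $f$ is $\mathcal{J}(f)=\{Af_X+Bf_Y;\ A,B\in\mathcal{O}\}\subseteq\mathcal{O}$, and $\mathcal{J}(f)_i=\pi_i(\mathcal{J}(f))$. For $L\subseteq I$,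 $\mathcal{N}_L(\mathcal{J}(f))=\{z\in\mathcal{J}(f):\ \pi_l(z)=0\ \text{for all } l\in L\}$, and $[1,i)=\{1,\ldots,i-1\}$. For a reduced plane curve germ $D$ defined by $g$, $\tau(D)=\dim_{\mathbb{C}}\mathbb{C}\{X,Y\}/\langle g,g_X,g_Y\rangle$. $\mathrm{I}(g,h)=\dim_{\mathbb{C}}\mathbb{C}\{X,Y\}/\langle g,h\rangle$. $\sharp$ denotes cardinality. *)

theory Defs
  imports
    "HOL-Complex_Analysis.Complex_Analysis"
    "HOL-Algebra.Algebra"
    "HOL-Library.Extended_Nat"
begin

section \<open>Convergent power series in two variables\<close>

text \<open>
  A series \<open>\<Sum> a\<^sub>i\<^sub>j X\<^sup>i Y\<^sup>j\<close> is encoded as a power series in \<open>Y\<close> whose coefficients are power series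
  in \<open>X\<close>, so that \<open>a\<^sub>i\<^sub>j\<close> is \<open>fps_nth (fps_nth g j) i\<close>.  It is convergent if it converges
  (absolutely) on some polydisc around the origin.
\<close>

definition convergent2 :: "complex fps fps \<Rightarrow> bool" where
  "convergent2 g \<longleftrightarrow>
     (\<exists>\<rho>>0. (\<lambda>(i, j). norm (fps_nth (fps_nth g j) i) * \<rho> ^ i * \<rho> ^ j) summable_on (UNIV :: (nat \<times> nat) set))"

definition CXY :: "complex fps fps ring" where
  "CXY = \<lparr>carrier = {g. convergent2 g}, mult = (*), one = 1, ring.zero = 0, add = (+)\<rparr>"

definition const2 :: "complex \<Rightarrow> complex fps fps" where
  "const2 c = fps_const (fps_const c)"

definition deriv_X :: "complex fps fps \<Rightarrow> complex fps fps" where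
  "deriv_X g = Abs_fps (\<lambda>j. fps_deriv (fps_nth g j))"

definition deriv_Y :: "complex fps fps \<Rightarrow> complex fps fps" where
  "deriv_Y g = fps_deriv g"


section \<open>Dimensions and cardinalities with values in \<open>\<nat> \<union> {\<infinity>}\<close>\<close>

text \<open>
  The complex dimension of \<open>\<complex>{X,Y}/J\<close> for an ideal \<open>J\<close>; the scalars are the classes of the constants.
  If \<open>J\<close> is the whole ring, the quotient and the set of scalars are both \<open>{\<zero>}\<close>, and the dimension is \<open>0\<close>.
\<close>

definition quot_dim :: "complex fps fps set \<Rightarrow> enat" where
  "quot_dim J =
     (let A = CXY Quot J; k = range (\<lambda>c. J +>\<^bsub>CXY\<^esub> const2 c)
      in if ring.finite_dimension A k (carrier A) then enat (ring.dim A k (carrier A)) else \<infinity>)"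

definition ecard :: "'a set \<Rightarrow> enat" where
  "ecard S = (if finite S then enat (card S) else \<infinity>)"

definition tjurina :: "complex fps fps \<Rightarrow> enat" where
  "tjurina g = quot_dim (Idl\<^bsub>CXY\<^esub> {g, deriv_X g, deriv_Y g})"

definition inter_mult :: "complex fps fps \<Rightarrow> complex fps fps \<Rightarrow> enat" where
  "inter_mult g h = quot_dim (Idl\<^bsub>CXY\<^esub> {g, h})"


section \<open>The local ring of a curve and its Jacobian ideal\<close>

definition local_ring :: "complex fps fps \<Rightarrow> complex fps fps set ring" where
  "local_ring f = CXY Quot (PIdl\<^bsub>CXY\<^esub> f)"

definition local_class :: "complex fps fps \<Rightarrow> complex fps fps \<Rightarrow> complex fps fps set" where
  "local_class f g = PIdl\<^bsub>CXY\<^esub> f +>\<^bsub>CXY\<^esub> g"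

definition jacobian_ideal :: "complex fps fps \<Rightarrow> complex fps fps set set" where
  "jacobian_ideal f =
     {A \<otimes>\<^bsub>local_ring f\<^esub> local_class f (deriv_X f)
        \<oplus>\<^bsub>local_ring f\<^esub> B \<otimes>\<^bsub>local_ring f\<^esub> local_class f (deriv_Y f) | A B.
      A \<in> carrier (local_ring f) \<and> B \<in> carrier (local_ring f)}"


section \<open>One-variable series and normalization of a branch\<close>

text \<open>
  The field of convergent Laurent series in \<open>t\<close>, i.e. the fraction field of \<open>\<complex>{t}\<close>.
  The condition says that the non-principal part has positive radius of convergence.
\<close>

definition Kt :: "complex fls ring" where
  "Kt = \<lparr>carrier = {z. fls_conv_radius z > 0}, mult = (*), one = 1, ring.zero = 0, add = (+)\<rparr>"

definition Ct :: "complex fls set" where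
  "Ct = fps_to_fls ` {p. fps_conv_radius p > 0}"

definition t_order :: "complex fls \<Rightarrow> ereal" where
  "t_order z = (if z = 0 then \<infinity> else ereal (of_int (fls_subdegree z)))"

definition integral_closure :: "complex fls set \<Rightarrow> complex fls set \<Rightarrow> complex fls set" where
  "integral_closure A L =
     {z \<in> L. \<exists>n::nat. \<exists>a. n > 0 \<and> (\<forall>k<n. a k \<in> A) \<and> z ^ n + (\<Sum>k<n. a k * z ^ k) = 0}"

text \<open>
  \<open>\<iota>\<close> identifies \<open>\<O> = \<complex>{X,Y}/\<langle>f\<rangle>\<close> with a \<open>\<complex>\<close>-subalgebra of \<open>Kt\<close> in such a way that \<open>Kt\<close> is the
  fraction field of \<open>\<O>\<close> and \<open>\<complex>{t}\<close> is the normalization of \<open>\<O>\<close>.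
\<close>

definition normalization_embedding ::
  "complex fps fps \<Rightarrow> (complex fps fps set \<Rightarrow> complex fls) \<Rightarrow> bool" where
  "normalization_embedding f \<iota> \<longleftrightarrow>
     \<iota> \<in> ring_hom (local_ring f) Kt \<and>
     inj_on \<iota> (carrier (local_ring f)) \<and>
     (\<forall>c. \<iota> (local_class f (const2 c)) = fls_const c) \<and>
     (\<forall>z \<in> carrier Kt. \<exists>a \<in> \<iota> ` carrier (local_ring f). \<exists>b \<in> \<iota> ` carrier (local_ring f).
        b \<noteq> 0 \<and> z = a / b) \<and>
     integral_closure (\<iota> ` carrier (local_ring f)) (carrier Kt) = Ct"


section \<open>The total ring of fractions\<close>

text \<open>
  Elements of \<open>\<K> = \<Prod>\<^sub>i \<K>\<^sub>i\<close> are families of Laurent series indexed by \<open>I\<close>.  The map below is the inclusion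
  \<open>\<O> \<subseteq> \<Prod>\<^sub>i \<O>\<^sub>i \<subseteq> \<K>\<close>, where \<open>\<O> = \<complex>{X,Y}/\<langle>f\<rangle>\<close> and \<open>f = \<Prod>\<^sub>i f\<^sub>i\<close>: since \<open>\<langle>f\<rangle> \<subseteq> \<langle>f\<^sub>i\<rangle>\<close>, the image in \<open>\<O>\<^sub>i\<close> of a
  coset \<open>z\<close> of \<open>\<langle>f\<rangle>\<close> is the coset \<open>z + \<langle>f\<^sub>i\<rangle>\<close>.
\<close>

definition incl_K ::
  "nat set \<Rightarrow> (nat \<Rightarrow> complex fps fps) \<Rightarrow> (nat \<Rightarrow> complex fps fps set \<Rightarrow> complex fls) \<Rightarrow>
   complex fps fps set \<Rightarrow> (nat \<Rightarrow> complex fls)" where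
  "incl_K I f \<iota> z = (\<lambda>i\<in>I. \<iota> i (z <+>\<^bsub>CXY\<^esub> PIdl\<^bsub>CXY\<^esub> (f i)))"

definition proj :: "nat \<Rightarrow> (nat \<Rightarrow> complex fls) \<Rightarrow> complex fls" where
  "proj i z = z i"

definition nu :: "nat \<Rightarrow> (nat \<Rightarrow> complex fls) \<Rightarrow> ereal" where
  "nu i z = t_order (proj i z)"

definition vanishing_part :: "nat set \<Rightarrow> (nat \<Rightarrow> complex fls) set \<Rightarrow> (nat \<Rightarrow> complex fls) set" where
  "vanishing_part L S = {z \<in> S. \<forall>l\<in>L. proj l z = 0}"

definition jacobian_K ::
  "nat set \<Rightarrow> (nat \<Rightarrow> complex fps fps) \<Rightarrow> (nat \<Rightarrow> complex fps fps set \<Rightarrow> complex fls) \<Rightarrow>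
   (nat \<Rightarrow> complex fls) set" where
  "jacobian_K I f \<iota> = incl_K I f \<iota> ` jacobian_ideal (\<Prod>i\<in>I. f i)"

end

(*
  Write P for the ideal (f, f_X, f_Y) of R = C{X,Y}, h_i for the product of the f_l with l < i and k_i
  for the product of the f_l with l > i.  The ideals P + (h_i) filter R/P.  By the isomorphism theorems
  the i-th graded piece is the quotient of (h_i) + (f_i) by N_i + (f_i), where N_i is the intersection
  of P and (h_i), that is, the part of P that vanishes on the branches before i.  Modulo f_i the
  gradient of f is h_i k_i times the gradient of f_i, hence
    N_i + (f_i)  <=  P + (f_i) = h_i k_i (f_i, (f_i)_X, (f_i)_Y) + (f_i)  <=  (h_i) + (f_i).
  Cancelling h_i, then k_i, the upper step contributes the Tjurina number of f_i and the intersection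
  numbers of f_i with the later branches.  The lower step is counted by orders in t_i, because
  N_i + (f_i) contains every element of sufficiently large order: the conductor of the i-th branch is
  not zero.  All dimensions are added in the extended naturals, so no finiteness is needed.
*)
theory Submission
  imports Defs
begin

section \<open>Relative codimension of subspaces\<close>

text \<open>Quotients are replaced by pairs of nested subspaces of one space, the formal double
  series over the complex numbers. A dimension becomes the length of a chain of one-vector
  extensions, which is the inductive shape of the algebraic \<open>dimension\<close> behind
  \<open>quot_dim\<close>, and an isomorphism theorem becomes a transport of chains. The obstacle is
  that the normalization is given only as an abstract embedding of algebras into Laurent series,
  with no parametrization and no continuity. A parametrization x(t), y(t) is recovered because
  homomorphisms between rings of convergent series are substitutions. A nonzero coordinate then
  makes C{t} a finite module over the convergent series in that coordinate, and this yields the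
  conductor. To use the conductor, N_i must contain an element that does not vanish on the i-th
  branch. It is built from a partial derivative of f_i that is not a multiple of f_i; such a
  derivative exists by comparing lowest total degrees. For i = 1 the ideal N_1 is all of P, so the
  sum over orders can start at 2.\<close>

locale codim_space = vector_space scale
  for scale :: "'a::field \<Rightarrow> 'b::ab_group_add \<Rightarrow> 'b" (infixr \<open>*\<^sub>C\<close> 75)
begin

definition adjoin :: "'b \<Rightarrow> 'b set \<Rightarrow> 'b set" where
  "adjoin v E = {x. \<exists>k. x - k *\<^sub>C v \<in> E}"

lemma subspace_adjoin:
  assumes "subspace E" shows "subspace (adjoin v E)"
proof (rule subspaceI)
  show "0 \<in> adjoin v E"
    using subspace_0[OF assms] unfolding adjoin_def by (auto intro!: exI[of _ 0])
next
  fix x y assume "x \<in> adjoin v E" "y \<in> adjoin v E"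
  then obtain k l where "x - k *\<^sub>C v \<in> E" "y - l *\<^sub>C v \<in> E" unfolding adjoin_def by auto
  from subspace_add[OF assms this] have "(x + y) - (k + l) *\<^sub>C v \<in> E"
    by (simp add: scale_left_distrib algebra_simps)
  then show "x + y \<in> adjoin v E" unfolding adjoin_def by auto
next
  fix c x assume "x \<in> adjoin v E"
  then obtain k where "x - k *\<^sub>C v \<in> E" unfolding adjoin_def by auto
  from subspace_scale[OF assms this, of c] have "c *\<^sub>C x - (c * k) *\<^sub>C v \<in> E"
    by (simp add: scale_right_diff_distrib)
  then show "c *\<^sub>C x \<in> adjoin v E" unfolding adjoin_def by auto
qed

lemma adjoin_superset: "E \<subseteq> adjoin v E"
  unfolding adjoin_def by (auto intro!: exI[of _ 0])

lemma adjoin_self: "subspace E \<Longrightarrow> v \<in> adjoin v E"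
  unfolding adjoin_def by (auto intro!: exI[of _ 1] simp: subspace_0)

lemma adjoin_least:
  assumes "subspace V" "E \<subseteq> V" "v \<in> V" shows "adjoin v E \<subseteq> V"
proof
  fix x assume "x \<in> adjoin v E"
  then obtain k where "x - k *\<^sub>C v \<in> V" using assms unfolding adjoin_def by auto
  from subspace_add[OF assms(1) this subspace_scale[OF assms(1,3), of k]] show "x \<in> V" by simp
qed

text \<open>Steinitz exchange: \<open>w\<close> is a multiple of \<open>v\<close> modulo
  \<open>E\<close>, the factor is nonzero because \<open>w\<close> is outside \<open>E\<close>, so
  the relation can be solved for \<open>v\<close>.\<close>

lemma adjoin_exchange:
  assumes "subspace E" "w \<in> adjoin v E" "w \<notin> E"
  shows "adjoin w E = adjoin v E" and "v \<in> adjoin w E"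
proof -
  from assms obtain k where k: "w - k *\<^sub>C v \<in> E" unfolding adjoin_def by auto
  have "k \<noteq> 0" using k assms by auto
  then have "v - inverse k *\<^sub>C w = (- inverse k) *\<^sub>C (w - k *\<^sub>C v)"
    by (simp add: scale_right_diff_distrib)
  then have "v - inverse k *\<^sub>C w \<in> E"
    using subspace_scale[OF assms(1) k, of "- inverse k"] by metis
  then show v: "v \<in> adjoin w E" unfolding adjoin_def by auto
  show "adjoin w E = adjoin v E"
    using adjoin_least[OF subspace_adjoin[OF assms(1)] adjoin_superset assms(2)]
      adjoin_least[OF subspace_adjoin[OF assms(1)] adjoin_superset v] by auto
qed

lemma adjoin_commute: "adjoin v (adjoin w E) = adjoin w (adjoin v E)"
proof -
  have "x - k *\<^sub>C v - l *\<^sub>C w = x - l *\<^sub>C w - k *\<^sub>C v" for x k l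
    by (simp add: algebra_simps)
  then show ?thesis unfolding adjoin_def by (auto; metis)
qed

text \<open>The chain starts at \<open>U\<close> instead of the zero space, so no quotient space is
  formed. It copies the rules of \<open>ring.dimension\<close>, which lets chains in a quotient ring
  be lifted step by step.\<close>

inductive codim_is :: "'b set \<Rightarrow> nat \<Rightarrow> 'b set \<Rightarrow> bool" for U where
  codim_is_0: "codim_is U 0 U"
| codim_is_Suc: "codim_is U n E \<Longrightarrow> v \<notin> E \<Longrightarrow> codim_is U (Suc n) (adjoin v E)"

definition codim :: "'b set \<Rightarrow> 'b set \<Rightarrow> enat" where
  "codim U V = (if \<exists>n. codim_is U n V then enat (THE n. codim_is U n V) else \<infinity>)"

lemma codim_is_subspace: "codim_is U n V \<Longrightarrow> subspace U \<Longrightarrow> subspace V"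
  by (induction rule: codim_is.induct) (auto intro: subspace_adjoin)

lemma codim_is_subset: "codim_is U n V \<Longrightarrow> U \<subseteq> V"
  by (induction rule: codim_is.induct) (use adjoin_superset in fastforce)+

lemma codim_is_trans:
  "codim_is W m V \<Longrightarrow> codim_is U n W \<Longrightarrow> codim_is U (n + m) V"
  by (induction rule: codim_is.induct) (auto intro: codim_is.intros)

text \<open>A vector outside the top of a chain is outside every member, so by exchange it can be
  adjoined to all members without making any extension trivial.\<close>

lemma codim_is_adjoin:
  "codim_is A m E \<Longrightarrow> subspace A \<Longrightarrow> w \<notin> E \<Longrightarrow> codim_is (adjoin w A) m (adjoin w E)"
proof (induction rule: codim_is.induct)
  case codim_is_0
  then show ?case by (auto intro: codim_is.intros)
next
  case (codim_is_Suc n E v)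
  note E = codim_is_subspace[OF codim_is_Suc(1,4)]
  have "w \<notin> E" using codim_is_Suc adjoin_superset by auto
  moreover have "v \<notin> adjoin w E" using adjoin_exchange(2)[OF E _ \<open>v \<notin> E\<close>] codim_is_Suc by auto
  ultimately have "codim_is (adjoin w A) (Suc n) (adjoin v (adjoin w E))"
    using codim_is_Suc by (auto intro: codim_is.intros)
  then show ?case by (simp add: adjoin_commute)
qed

text \<open>Induction on the chain, looking at its last extension from \<open>E\<close> to
  \<open>adjoin v E\<close>. If \<open>W\<close> lies in \<open>E\<close>, that extension belongs to
  the upper part. Otherwise \<open>W \<inter> E\<close> is a hyperplane of \<open>W\<close>, and the
  extension is charged to the lower part.\<close>

lemma codim_is_split:
  assumes "codim_is U k V" "subspace U" "subspace W" "U \<subseteq> W" "W \<subseteq> V"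
  shows "\<exists>n m. k = n + m \<and> codim_is U n W \<and> codim_is W m V"
  using assms
proof (induction arbitrary: W rule: codim_is.induct)
  case codim_is_0
  then have "W = U" by auto
  then show ?case by (auto intro: codim_is.intros)
next
  case (codim_is_Suc n E v)
  note E = codim_is_subspace[OF codim_is_Suc(1,4)]
  show ?case
  proof (cases "W \<subseteq> E")
    case True
    with codim_is_Suc obtain a b where "n = a + b" "codim_is U a W" "codim_is W b E" by metis
    with codim_is_Suc(2) show ?thesis
      by (intro exI[of _ a] exI[of _ "Suc b"]) (auto intro: codim_is.intros)
  next
    case False
    \<comment> \<open>This \<open>w\<close> replaces \<open>v\<close> as the last adjoined vector.
      It also carries the chain from \<open>W \<inter> E\<close> to \<open>E\<close> over to a chain
      from \<open>W\<close> to \<open>adjoin v E\<close>.\<close>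
    then obtain w where w: "w \<in> W" "w \<notin> E" by auto
    have eq: "adjoin w E = adjoin v E" using adjoin_exchange[OF E] w codim_is_Suc by auto
    have WE: "subspace (W \<inter> E)" using E codim_is_Suc by (auto intro: subspace_inter)
    have W: "adjoin w (W \<inter> E) = W"
    proof
      show "adjoin w (W \<inter> E) \<subseteq> W" using adjoin_least codim_is_Suc w by auto
      show "W \<subseteq> adjoin w (W \<inter> E)"
      proof
        fix x assume x: "x \<in> W"
        then have "x \<in> adjoin w E" using eq codim_is_Suc(7) by auto
        then obtain k where "x - k *\<^sub>C w \<in> E" unfolding adjoin_def by auto
        moreover have "x - k *\<^sub>C w \<in> W"
          using x w codim_is_Suc by (auto intro: subspace_diff subspace_scale)
        ultimately show "x \<in> adjoin w (W \<inter> E)" unfolding adjoin_def by auto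
      qed
    qed
    obtain a b where ab: "n = a + b" "codim_is U a (W \<inter> E)" "codim_is (W \<inter> E) b E"
      using codim_is_Suc(3)[OF codim_is_Suc(4) WE] codim_is_Suc codim_is_subset[OF codim_is_Suc(1)]
      by auto
    have "codim_is U (Suc a) W"
      using codim_is.codim_is_Suc[OF ab(2), of w] w W by auto
    moreover have "codim_is W b (adjoin v E)"
      using codim_is_adjoin[OF ab(3) WE w(2)] W eq by auto
    ultimately show ?thesis using ab by (intro exI[of _ "Suc a"] exI[of _ b]) auto
  qed
qed

lemma codim_is_pos: "codim_is U n V \<Longrightarrow> n > 0 \<Longrightarrow> subspace U \<Longrightarrow> U \<subset> V"
proof (induction rule: codim_is.induct)
  case (codim_is_Suc n E v)
  have "U \<subseteq> E" "subspace E" using codim_is_subset[OF codim_is_Suc(1)] codim_is_subspace[OF codim_is_Suc(1)] codim_is_Suc by auto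
  then show ?case using adjoin_superset[of E v] adjoin_self[of E v] codim_is_Suc(2) by blast
qed simp

text \<open>The second chain is split at the penultimate member \<open>E\<close> of the first one.
  Its upper part has length one, because no subspace lies strictly between \<open>E\<close> and
  \<open>adjoin v E\<close>.\<close>

lemma codim_is_unique:
  assumes "codim_is U n V" "codim_is U m V" "subspace U"
  shows "n = m"
  using assms
proof (induction arbitrary: m rule: codim_is.induct)
  case codim_is_0
  then show ?case using codim_is_pos[of U m U] by auto
next
  case (codim_is_Suc n E v)
  note E = codim_is_subspace[OF codim_is_Suc(1,5)]
  obtain a b where ab: "m = a + b" "codim_is U a E" "codim_is E b (adjoin v E)"
    using codim_is_split[OF codim_is_Suc(4,5) E codim_is_subset[OF codim_is_Suc(1)] adjoin_superset]
    by auto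
  have "a = n" using codim_is_Suc(3)[OF ab(2) codim_is_Suc(5)] by simp
  have "b = 1" using ab(3)
  proof (cases rule: codim_is.cases)
    case codim_is_0
    then show ?thesis using adjoin_self[OF E, of v] codim_is_Suc(2) by simp
  next
    case (codim_is_Suc c E' v')
    have E': "subspace E'" "E \<subseteq> E'"
      using codim_is_subspace[OF codim_is_Suc(3) E] codim_is_subset[OF codim_is_Suc(3)] by simp_all
    have "E' \<subseteq> E"
    proof
      fix w assume w: "w \<in> E'"
      show "w \<in> E"
      proof (rule ccontr)
        assume "w \<notin> E"
        moreover have "w \<in> adjoin v E" using w codim_is_Suc(2) adjoin_superset by auto
        ultimately have "adjoin v E = adjoin w E" using adjoin_exchange(1)[OF E] by simp
        then have "adjoin v E \<subseteq> E'" using adjoin_least[OF E'(1,2) w] by simp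
        then show False using codim_is_Suc(2,4) adjoin_self[OF E'(1), of v'] by auto
      qed
    qed
    then have "E' = E" using E' by auto
    then have "c = 0" using codim_is_pos[of E c E] codim_is_Suc(3) E by auto
    then show ?thesis using codim_is_Suc(1) by simp
  qed
  then show ?case using ab \<open>a = n\<close> by simp
qed

lemma codim_eqI: "codim_is U n V \<Longrightarrow> subspace U \<Longrightarrow> codim U V = enat n"
  unfolding codim_def using codim_is_unique by (auto intro!: the_equality)

lemma codim_self: "subspace U \<Longrightarrow> codim U U = 0"
  using codim_eqI[OF codim_is_0] by (simp add: zero_enat_def)

lemma codim_infinite: "(\<And>n. \<not> codim_is U n V) \<Longrightarrow> codim U V = \<infinity>"
  unfolding codim_def by simp

text \<open>Finite chains can be concatenated and split, so the left side is finite exactly when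
  both summands are; the equation therefore also holds with infinite values.\<close>

lemma codim_add:
  assumes "subspace U" "subspace W" "U \<subseteq> W" "W \<subseteq> V"
  shows "codim U V = codim U W + codim W V"
proof (cases "\<exists>k. codim_is U k V")
  case True
  then obtain k where k: "codim_is U k V" by auto
  from codim_is_split[OF k assms] obtain n m where
    "k = n + m" "codim_is U n W" "codim_is W m V" by auto
  then show ?thesis using codim_eqI k assms by simp
next
  case False
  then have "codim U V = \<infinity>" by (simp add: codim_infinite)
  moreover have "codim U W = \<infinity> \<or> codim W V = \<infinity>"
    using False codim_is_trans[of W _ V U] codim_infinite by meson
  ultimately show ?thesis by auto
qed

text \<open>This is invariance of dimension under the map from V/U to V'/U' induced by
  \<open>\<phi>\<close>: the assumption \<open>ker\<close> makes it well defined and injective, the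
  form of \<open>V'\<close> makes it surjective. Chains are pushed forward and pulled back.\<close>

lemma codim_linear_bij:
  assumes lin: "Vector_Spaces.linear scale scale \<phi>"
    and U: "subspace U" and V: "subspace V" and U': "subspace U'" and UV: "U \<subseteq> V"
    and ker: "\<And>x. x \<in> V \<Longrightarrow> \<phi> x \<in> U' \<longleftrightarrow> x \<in> U"
    and V': "V' = {u + \<phi> x | u x. u \<in> U' \<and> x \<in> V}"
  shows "codim U V = codim U' V'"
proof -
  interpret lin: Vector_Spaces.linear scale scale \<phi> by (rule lin)
  have push: "\<exists>E'. codim_is U' n E' \<and> E' = {u + \<phi> x | u x. u \<in> U' \<and> x \<in> E}"
    if "codim_is U n E" "E \<subseteq> V" for n E
    using that
  proof (induction rule: codim_is.induct)
    case codim_is_0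
    have "U' = {u + \<phi> x | u x. u \<in> U' \<and> x \<in> U}"
    proof (intro Set.set_eqI iffI)
      fix u assume "u \<in> U'"
      then show "u \<in> {u + \<phi> x | u x. u \<in> U' \<and> x \<in> U}"
        using subspace_0[OF U] by (intro CollectI exI[of _ u] exI[of _ 0]) (simp add: lin.zero)
    next
      fix u assume "u \<in> {u + \<phi> x | u x. u \<in> U' \<and> x \<in> U}"
      then show "u \<in> U'" using ker UV subspace_add[OF U'] by auto
    qed
    then show ?case by (auto intro: codim_is.intros)
  next
    case (codim_is_Suc n E v)
    let ?E' = "{u + \<phi> x | u x. u \<in> U' \<and> x \<in> E}"
    note E = codim_is_subspace[OF codim_is_Suc(1) U]
    have EV: "E \<subseteq> V" "v \<in> V" using codim_is_Suc adjoin_superset[of E v] adjoin_self[OF E, of v] by auto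
    have "codim_is U' n ?E'" using codim_is_Suc EV by auto
    moreover have "\<phi> v \<notin> ?E'"
    proof
      assume "\<phi> v \<in> ?E'"
      then obtain u x where ux: "\<phi> v = u + \<phi> x" "u \<in> U'" "x \<in> E" by auto
      then have "\<phi> (v - x) \<in> U'" by (simp add: lin.diff)
      then have "v - x \<in> U" using ker EV ux V by (auto intro: subspace_diff)
      then have "v - x \<in> E" using codim_is_subset[OF codim_is_Suc(1)] by auto
      from subspace_add[OF E this ux(3)] codim_is_Suc show False by simp
    qed
    ultimately have "codim_is U' (Suc n) (adjoin (\<phi> v) ?E')" by (rule codim_is.intros)
    moreover have "adjoin (\<phi> v) ?E' = {u + \<phi> x | u x. u \<in> U' \<and> x \<in> adjoin v E}"
    proof (intro Set.set_eqI iffI)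
      fix y assume "y \<in> adjoin (\<phi> v) ?E'"
      then obtain k u x where *: "y - k *\<^sub>C \<phi> v = u + \<phi> x" "u \<in> U'" "x \<in> E"
        unfolding adjoin_def by auto
      then have "y = u + \<phi> (x + k *\<^sub>C v)" by (simp add: lin.add lin.scale algebra_simps)
      moreover have "x + k *\<^sub>C v \<in> adjoin v E" using * unfolding adjoin_def by (auto intro!: exI[of _ k])
      ultimately show "y \<in> {u + \<phi> x | u x. u \<in> U' \<and> x \<in> adjoin v E}" using * by auto
    next
      fix y assume "y \<in> {u + \<phi> x | u x. u \<in> U' \<and> x \<in> adjoin v E}"
      then obtain u x k where *: "y = u + \<phi> x" "u \<in> U'" "x - k *\<^sub>C v \<in> E"
        unfolding adjoin_def by auto
      have "y - k *\<^sub>C \<phi> v = u + \<phi> (x - k *\<^sub>C v)" using * by (simp add: lin.diff lin.scale)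
      then show "y \<in> adjoin (\<phi> v) ?E'" using * unfolding adjoin_def by blast
    qed
    ultimately show ?case by auto
  qed
  have pull: "codim_is U n {x \<in> V. \<phi> x \<in> E}" if "codim_is U' n E" "E \<subseteq> V'" for n E
    using that
  proof (induction rule: codim_is.induct)
    case codim_is_0
    have "{x \<in> V. \<phi> x \<in> U'} = U" using ker UV by auto
    then show ?case by (auto intro: codim_is.intros)
  next
    case (codim_is_Suc n E v)
    note E = codim_is_subspace[OF codim_is_Suc(1) U']
    have UE: "U' \<subseteq> E" using codim_is_subset[OF codim_is_Suc(1)] .
    have EV: "E \<subseteq> V'" "v \<in> V'" using codim_is_Suc adjoin_superset[of E v] adjoin_self[OF E, of v] by auto
    then obtain u w where w: "v = u + \<phi> w" "u \<in> U'" "w \<in> V" using V' by auto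
    have "\<phi> w \<notin> E" using w codim_is_Suc(2) subspace_add[OF E] UE by auto
    then have "codim_is U (Suc n) (adjoin w {x \<in> V. \<phi> x \<in> E})"
      using codim_is_Suc EV by (auto intro: codim_is.intros)
    moreover have "adjoin w {x \<in> V. \<phi> x \<in> E} = {x \<in> V. \<phi> x \<in> adjoin v E}"
    proof (intro Set.set_eqI)
      fix x
      \<comment> \<open>The vectors \<open>v\<close> and \<open>\<phi> w\<close> differ by
        \<open>u\<close>, which lies in \<open>U'\<close> and hence in \<open>E\<close>, so they
        define the same extension of \<open>E\<close>.\<close>
      have 1: "\<phi> x - k *\<^sub>C v \<in> E \<longleftrightarrow> \<phi> (x - k *\<^sub>C w) \<in> E" for k
      proof -
        have "k *\<^sub>C u \<in> E" using w UE subspace_scale[OF E] by auto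
        moreover have "\<phi> x - k *\<^sub>C v = \<phi> (x - k *\<^sub>C w) - k *\<^sub>C u"
          using w by (simp add: lin.diff lin.scale scale_right_distrib)
        moreover have "\<phi> (x - k *\<^sub>C w) = (\<phi> x - k *\<^sub>C v) + k *\<^sub>C u"
          using w by (simp add: lin.diff lin.scale scale_right_distrib)
        ultimately show ?thesis using subspace_add[OF E] subspace_diff[OF E] by metis
      qed
      have 2: "x - k *\<^sub>C w \<in> V \<longleftrightarrow> x \<in> V" for k
        using w V subspace_diff[OF V, of x "k *\<^sub>C w"] subspace_add[OF V, of "x - k *\<^sub>C w" "k *\<^sub>C w"]
        by (auto intro: subspace_scale)
      show "x \<in> adjoin w {x \<in> V. \<phi> x \<in> E} \<longleftrightarrow> x \<in> {x \<in> V. \<phi> x \<in> adjoin v E}"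
        unfolding adjoin_def using 1 2 by auto
    qed
    ultimately show ?case by simp
  qed
  show ?thesis
  proof (cases "\<exists>n. codim_is U n V")
    case True
    then obtain n where n: "codim_is U n V" by auto
    then have "codim_is U' n V'" using push[OF n] V' by auto
    then show ?thesis using n codim_eqI U U' by simp
  next
    case False
    \<comment> \<open>A finite chain up to \<open>V'\<close> would pull back to one up to this set,
      so infinite codimension transfers as well.\<close>
    have "{x \<in> V. \<phi> x \<in> V'} = V" using V' subspace_0[OF U'] by force
    then have "\<not> codim_is U' n V'" for n using False pull[of n V'] by auto
    then show ?thesis using False codim_infinite by simp
  qed
qed

end

section \<open>Convergent power series\<close>

text \<open>The Cauchy estimates. A geometric bound on the coefficients is easier to combine than
  summability on a polydisc, and the normalization \<open>A \<ge> 1\<close> allows two bounds to be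
  merged by taking the maximum of their ratios.\<close>

lemma convergent2_iff:
  "convergent2 g \<longleftrightarrow> (\<exists>C A. A \<ge> 1 \<and> (\<forall>i j. norm (fps_nth (fps_nth g j) i) \<le> C * A ^ (i + j)))"
  (is "_ \<longleftrightarrow> ?R")
proof
  assume "convergent2 g"
  then obtain \<rho> where \<rho>: "\<rho> > 0" and
    summ: "(\<lambda>(i, j). norm (fps_nth (fps_nth g j) i) * \<rho> ^ i * \<rho> ^ j) summable_on (UNIV :: (nat \<times> nat) set)"
    (is "?f summable_on _") unfolding convergent2_def by auto
  define A where "A = max 1 (1 / \<rho>)"
  have A: "A \<ge> 1" "A * \<rho> \<ge> 1" using \<rho> unfolding A_def by (auto simp: max_def field_simps)
  have "norm (fps_nth (fps_nth g j) i) \<le> infsum ?f UNIV * A ^ (i + j)" for i j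
  proof -
    have "sum ?f {(i, j)} \<le> infsum ?f UNIV"
      using summ \<rho> by (intro finite_sum_le_infsum) auto
    then have *: "norm (fps_nth (fps_nth g j) i) * \<rho> ^ (i + j) \<le> infsum ?f UNIV"
      by (simp add: power_add mult.assoc)
    have "norm (fps_nth (fps_nth g j) i) * 1 \<le> norm (fps_nth (fps_nth g j) i) * (A * \<rho>) ^ (i + j)"
      using one_le_power[OF A(2), of "i + j"] by (intro mult_left_mono) auto
    also have "\<dots> = (norm (fps_nth (fps_nth g j) i) * \<rho> ^ (i + j)) * A ^ (i + j)"
      by (simp add: power_mult_distrib)
    also have "\<dots> \<le> infsum ?f UNIV * A ^ (i + j)"
      using * A by (intro mult_right_mono) auto
    finally show ?thesis by simp
  qed
  with A show ?R by blast
next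
  assume ?R
  then obtain C A where A: "A \<ge> 1" and C: "\<And>i j. norm (fps_nth (fps_nth g j) i) \<le> C * A ^ (i + j)"
    by auto
  \<comment> \<open>Half of the radius suggested by the bound: the terms are then dominated by C
    (1/2)^i (1/2)^j, whose sum is at most 4 C.\<close>
  define \<rho> where "\<rho> = 1 / (2 * A)"
  have \<rho>: "\<rho> > 0" "A * \<rho> = 1 / 2" using A unfolding \<rho>_def by auto
  have C0: "C \<ge> 0" using order_trans[OF norm_ge_zero C[of 0 0]] by simp
  let ?f = "\<lambda>(i, j). norm (fps_nth (fps_nth g j) i) * \<rho> ^ i * \<rho> ^ j"
  have bound: "?f (i, j) \<le> C * ((1 / 2) ^ i * (1 / 2) ^ j)" for i j
  proof -
    have "?f (i, j) \<le> C * A ^ (i + j) * \<rho> ^ (i + j)"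
      using mult_right_mono[OF C[of j i], of "\<rho> ^ (i + j)"] \<rho> by (simp add: power_add mult.assoc)
    also have "\<dots> = C * (A * \<rho>) ^ (i + j)" by (simp add: power_mult_distrib)
    also have "\<dots> = C * ((1 / 2) ^ i * (1 / 2) ^ j)" by (simp only: \<rho> power_add)
    finally show ?thesis .
  qed
  have "?f summable_on UNIV"
  proof (rule nonneg_bdd_above_summable_on)
    show "bdd_above (sum ?f ` {F. F \<subseteq> UNIV \<and> finite F})"
    proof (rule bdd_aboveI2)
      fix F :: "(nat \<times> nat) set" assume "F \<in> {F. F \<subseteq> UNIV \<and> finite F}"
      then have F: "finite F" by simp
      \<comment> \<open>A finite set of index pairs is enlarged to a square, on which the double sum
        factors into two geometric sums.\<close>
      define n where "n = Suc (Max (insert 0 (fst ` F \<union> snd ` F)))"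
      have sub: "F \<subseteq> {..<n} \<times> {..<n}"
      proof
        fix p assume "p \<in> F"
        then have "fst p \<le> Max (insert 0 (fst ` F \<union> snd ` F))"
          "snd p \<le> Max (insert 0 (fst ` F \<union> snd ` F))"
          using F by (auto intro!: Max_ge)
        then show "p \<in> {..<n} \<times> {..<n}" unfolding n_def by (cases p) auto
      qed
      have geo: "(\<Sum>i<n. (1 / 2) ^ i) \<le> (2 :: real)"
        by (simp add: sum_gp_strict)
      have "sum ?f F \<le> sum ?f ({..<n} \<times> {..<n})"
        using sub \<rho> by (intro sum_mono2) auto
      also have "\<dots> \<le> (\<Sum>p\<in>{..<n} \<times> {..<n}. C * ((1 / 2) ^ fst p * (1 / 2) ^ snd p))"
        using bound by (intro sum_mono) (auto simp: mult.assoc)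
      also have "\<dots> = C * ((\<Sum>i<n. (1 / 2) ^ i) * (\<Sum>j<n. (1 / 2) ^ j))"
        unfolding sum_distrib_left[symmetric] by (simp add: sum_product sum.cartesian_product case_prod_beta)
      also have "\<dots> \<le> C * (2 * 2)"
        using geo C0 by (intro mult_left_mono mult_mono) (auto intro: sum_nonneg)
      finally show "sum ?f F \<le> C * (2 * 2)" .
    qed
  qed (use \<rho> in auto)
  then show "convergent2 g" using \<rho> unfolding convergent2_def by blast
qed

lemma convergent2I:
  assumes "\<And>i j. norm (fps_nth (fps_nth g j) i) \<le> C * A ^ (i + j)" "A \<ge> 1"
  shows "convergent2 g"
  using assms convergent2_iff by blast

lemma convergent2E:
  assumes "convergent2 g"
  obtains C A where "A \<ge> 1" "C \<ge> 0" "\<And>i j. norm (fps_nth (fps_nth g j) i) \<le> C * A ^ (i + j)"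
proof -
  obtain C A where *: "A \<ge> 1" "\<And>i j. norm (fps_nth (fps_nth g j) i) \<le> C * A ^ (i + j)"
    using assms convergent2_iff by blast
  have "C \<ge> 0" using order_trans[OF norm_ge_zero *(2)[of 0 0]] by simp
  then show ?thesis using that * by simp
qed

lemma convergent2_add:
  assumes "convergent2 g" "convergent2 h" shows "convergent2 (g + h)"
proof -
  obtain A C where 1: "A \<ge> 1" "C \<ge> 0" "\<And>i j. norm (fps_nth (fps_nth g j) i) \<le> C * A ^ (i + j)"
    by (rule convergent2E[OF assms(1)]) (rule that)
  obtain B D where 2: "B \<ge> 1" "D \<ge> 0" "\<And>i j. norm (fps_nth (fps_nth h j) i) \<le> D * B ^ (i + j)"
    by (rule convergent2E[OF assms(2)]) (rule that)
  show ?thesis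
  proof (rule convergent2I)
    fix i j
    have "norm (fps_nth (fps_nth (g + h) j) i) \<le> C * A ^ (i + j) + D * B ^ (i + j)"
      using 1(3)[of j i] 2(3)[of j i] by (simp add: norm_triangle_mono)
    also have "\<dots> \<le> C * max A B ^ (i + j) + D * max A B ^ (i + j)"
      using 1 2 by (intro add_mono mult_left_mono power_mono) auto
    finally show "norm (fps_nth (fps_nth (g + h) j) i) \<le> (C + D) * max A B ^ (i + j)"
      by (simp add: algebra_simps)
  qed (use 1 in auto)
qed

text \<open>Absorbs polynomial factors, namely the number of terms in a Cauchy product or the factor
  produced by a derivative, into the geometric bound at the price of doubling its ratio.\<close>

lemma Suc_mult_Suc_le_power2: "(real i + 1) * (real j + 1) \<le> 2 ^ (i + j)"
proof -
  have "real i + 1 \<le> 2 ^ i" for i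
  proof -
    have "real (Suc i) \<le> real (2 ^ i)" by (intro of_nat_mono Suc_leI) (rule less_exp)
    then show ?thesis by simp
  qed
  then show ?thesis unfolding power_add by (intro mult_mono) auto
qed

lemma convergent2_mult:
  assumes "convergent2 g" "convergent2 h" shows "convergent2 (g * h)"
proof -
  obtain A C where 1: "A \<ge> 1" "C \<ge> 0" "\<And>i j. norm (fps_nth (fps_nth g j) i) \<le> C * A ^ (i + j)"
    by (rule convergent2E[OF assms(1)]) (rule that)
  obtain B D where 2: "B \<ge> 1" "D \<ge> 0" "\<And>i j. norm (fps_nth (fps_nth h j) i) \<le> D * B ^ (i + j)"
    by (rule convergent2E[OF assms(2)]) (rule that)
  define M where "M = max A B"
  have M: "M \<ge> 1" using 1 unfolding M_def by auto
  show ?thesis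
  proof (rule convergent2I)
    fix i j
    have summand: "norm (fps_nth (fps_nth g k) l * fps_nth (fps_nth h (j - k)) (i - l)) \<le> C * D * M ^ (i + j)"
      if "k \<le> j" "l \<le> i" for k l
    proof -
      have "norm (fps_nth (fps_nth g k) l * fps_nth (fps_nth h (j - k)) (i - l))
         \<le> (C * A ^ (l + k)) * (D * B ^ (i - l + (j - k)))"
        unfolding norm_mult using 1 2 by (intro mult_mono) auto
      also have "\<dots> \<le> (C * M ^ (l + k)) * (D * M ^ (i - l + (j - k)))"
        using 1 2 unfolding M_def by (intro mult_mono mult_left_mono power_mono) auto
      also have "\<dots> = C * D * M ^ (l + k + (i - l + (j - k)))" by (simp add: power_add)
      also have "l + k + (i - l + (j - k)) = i + j" using that by simp
      finally show ?thesis .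
    qed
    have "fps_nth (fps_nth (g * h) j) i =
        (\<Sum>k=0..j. \<Sum>l=0..i. fps_nth (fps_nth g k) l * fps_nth (fps_nth h (j - k)) (i - l))"
      by (simp add: fps_mult_nth fps_sum_nth)
    also have "norm \<dots> \<le> (\<Sum>k=0..j. \<Sum>l=0..i. C * D * M ^ (i + j))"
      using summand by (intro sum_norm_le) auto
    also have "\<dots> = ((real i + 1) * (real j + 1)) * (C * D * M ^ (i + j))" by (simp add: algebra_simps)
    also have "\<dots> \<le> 2 ^ (i + j) * (C * D * M ^ (i + j))"
      using Suc_mult_Suc_le_power2 1 2 M by (intro mult_right_mono) auto
    also have "\<dots> = C * D * (2 * M) ^ (i + j)" by (simp add: power_mult_distrib)
    finally show "norm (fps_nth (fps_nth (g * h) j) i) \<le> C * D * (2 * M) ^ (i + j)" .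
  qed (use M in simp)
qed

lemma norm_one_plus_of_nat: "norm (1 + of_nat n :: complex) = real n + 1"
  using norm_of_nat[of "Suc n", where 'a = complex] by (simp del: norm_of_nat)

lemma convergent2_deriv_X:
  assumes "convergent2 g" shows "convergent2 (deriv_X g)"
proof -
  obtain A C where 1: "A \<ge> 1" "C \<ge> 0" "\<And>i j. norm (fps_nth (fps_nth g j) i) \<le> C * A ^ (i + j)"
    by (rule convergent2E[OF assms(1)]) (rule that)
  show ?thesis
  proof (rule convergent2I)
    fix i j
    have "norm (fps_nth (fps_nth (deriv_X g) j) i) = (real i + 1) * norm (fps_nth (fps_nth g j) (Suc i))"
      by (simp add: deriv_X_def norm_mult norm_one_plus_of_nat)
    also have "\<dots> \<le> 2 ^ (i + j) * (C * A ^ (Suc i + j))"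
      using Suc_mult_Suc_le_power2[of i 0] 1(1,2) 1(3)[of j "Suc i"]
      by (intro mult_mono order_trans[OF _ power_increasing[of i "i + j" 2]]) auto
    also have "\<dots> = C * A * (2 * A) ^ (i + j)" by (simp add: power_mult_distrib)
    finally show "norm (fps_nth (fps_nth (deriv_X g) j) i) \<le> C * A * (2 * A) ^ (i + j)" .
  qed (use 1 in simp)
qed

text \<open>The factor coming from \<open>fps_deriv\<close> is a natural number in the ring of
  series in X. It has to be recognized as a constant series before coefficients of X can be read
  off.\<close>

lemma deriv_Y_nth:
  "fps_nth (fps_nth (deriv_Y g) j) i = of_nat (Suc j) * fps_nth (fps_nth g (Suc j)) i"
proof -
  have "of_nat m * h = fps_const (of_nat m) * h" for m :: nat and h :: "complex fps"
    by (simp add: fps_of_nat)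
  then show ?thesis unfolding deriv_Y_def by (simp del: of_nat_Suc)
qed

lemma convergent2_deriv_Y:
  assumes "convergent2 g" shows "convergent2 (deriv_Y g)"
proof -
  obtain A C where 1: "A \<ge> 1" "C \<ge> 0" "\<And>i j. norm (fps_nth (fps_nth g j) i) \<le> C * A ^ (i + j)"
    by (rule convergent2E[OF assms(1)]) (rule that)
  show ?thesis
  proof (rule convergent2I)
    fix i j
    have "norm (fps_nth (fps_nth (deriv_Y g) j) i) = (real j + 1) * norm (fps_nth (fps_nth g (Suc j)) i)"
      by (simp add: deriv_Y_nth norm_mult norm_one_plus_of_nat)
    also have "\<dots> \<le> 2 ^ (i + j) * (C * A ^ (i + Suc j))"
      using Suc_mult_Suc_le_power2[of 0 j] 1(1,2) 1(3)[of "Suc j" i]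
      by (intro mult_mono order_trans[OF _ power_increasing[of j "i + j" 2]]) auto
    also have "\<dots> = C * A * (2 * A) ^ (i + j)" by (simp add: power_mult_distrib)
    finally show "norm (fps_nth (fps_nth (deriv_Y g) j) i) \<le> C * A * (2 * A) ^ (i + j)" .
  qed (use 1 in simp)
qed

section \<open>Convergent series in one variable inside C{X,Y}\<close>

lemma fps_conv_radius_pos_bound:
  fixes p :: "complex fps"
  assumes "fps_conv_radius p > 0"
  obtains C A where "A \<ge> 1" "C \<ge> 0" "\<And>n. norm (fps_nth p n) \<le> C * A ^ n"
proof -
  obtain \<rho> where \<rho>: "0 < ereal \<rho>" "ereal \<rho> < fps_conv_radius p"
    using ereal_dense2[OF assms] by auto
  have "summable (\<lambda>n. norm (fps_nth p n * of_real \<rho> ^ n))"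
    using \<rho> by (intro norm_summable_fps) auto
  then have "Bseq (\<lambda>n. norm (fps_nth p n * of_real \<rho> ^ n))"
    using summable_LIMSEQ_zero convergent_imp_Bseq convergentI by blast
  then obtain C where C: "C > 0" "\<And>n. norm (fps_nth p n) * \<rho> ^ n \<le> C"
    using \<rho> by (auto elim!: BseqE simp: norm_mult norm_power)
  define A where "A = max 1 (1 / \<rho>)"
  have A: "A \<ge> 1" "A * \<rho> \<ge> 1" using \<rho> unfolding A_def by (auto simp: max_def field_simps)
  have "norm (fps_nth p n) \<le> C * A ^ n" for n
  proof -
    have "norm (fps_nth p n) * 1 \<le> norm (fps_nth p n) * (A * \<rho>) ^ n"
      using one_le_power[OF A(2), of n] by (intro mult_left_mono) auto
    also have "\<dots> = (norm (fps_nth p n) * \<rho> ^ n) * A ^ n" by (simp add: power_mult_distrib)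
    also have "\<dots> \<le> C * A ^ n" using C A by (intro mult_right_mono) auto
    finally show ?thesis by simp
  qed
  from that[OF A(1) _ this] C show ?thesis by simp
qed

text \<open>Sends p(t) to p(Y). With series in Y over series in X, the companion p(X) is simply
  \<open>fps_const p\<close>; in particular X is \<open>fps_const fps_X\<close> and Y is
  \<open>fps_X\<close>.\<close>

definition lift_Y :: "complex fps \<Rightarrow> complex fps fps" where
  "lift_Y p = Abs_fps (\<lambda>j. fps_const (fps_nth p j))"

lemma convergent2_fps_const: "fps_conv_radius p > 0 \<Longrightarrow> convergent2 (fps_const p)"
proof -
  assume "fps_conv_radius p > 0"
  then obtain A C where 1: "A \<ge> 1" "C \<ge> 0" "\<And>n. norm (fps_nth p n) \<le> C * A ^ n"
    by (rule fps_conv_radius_pos_bound) (rule that)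
  then show ?thesis by (intro convergent2I[of _ C A]) auto
qed

lemma convergent2_lift_Y: "fps_conv_radius p > 0 \<Longrightarrow> convergent2 (lift_Y p)"
proof -
  assume "fps_conv_radius p > 0"
  then obtain A C where 1: "A \<ge> 1" "C \<ge> 0" "\<And>n. norm (fps_nth p n) \<le> C * A ^ n"
    by (rule fps_conv_radius_pos_bound) (rule that)
  then show ?thesis by (intro convergent2I[of _ C A]) (auto simp: lift_Y_def)
qed

lemma lift_Y_mult: "lift_Y (p * q) = lift_Y p * lift_Y q"
  by (intro fps_ext) (simp add: lift_Y_def fps_mult_nth fps_sum_nth)

lemma lift_Y_add: "lift_Y (p + q) = lift_Y p + lift_Y q"
  by (intro fps_ext) (simp add: lift_Y_def)

lemma lift_Y_const: "lift_Y (fps_const c) = const2 c"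
  by (intro fps_ext) (auto simp: lift_Y_def const2_def)

lemma lift_Y_X: "lift_Y fps_X = fps_X"
  by (intro fps_ext) (auto simp: lift_Y_def)

lemma convergent2_const2: "convergent2 (const2 c)"
  unfolding const2_def by (rule convergent2_fps_const) simp

lemma const2_simps [simp]:
  "const2 0 = 0" "const2 1 = 1" "const2 (a + b) = const2 a + const2 b"
  "const2 (a * b) = const2 a * const2 b" "const2 (- a) = - const2 a"
  by (simp_all add: const2_def)

lemma convergent2_0: "convergent2 0" and convergent2_1: "convergent2 1"
  using convergent2_const2[of 0] convergent2_const2[of 1] by simp_all

lemma convergent2_uminus: "convergent2 g \<Longrightarrow> convergent2 (- g)"
  using convergent2_mult[OF convergent2_const2[of "-1"], of g] by simp

lemma convergent2_diff: "convergent2 g \<Longrightarrow> convergent2 h \<Longrightarrow> convergent2 (g - h)"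
  using convergent2_add[of g "- h"] convergent2_uminus[of h] by simp

lemma convergent2_prod: "(\<And>i. i \<in> S \<Longrightarrow> convergent2 (g i)) \<Longrightarrow> convergent2 (prod g S)"
  by (induction S rule: infinite_finite_induct) (auto intro: convergent2_1 convergent2_mult)

lemmas convergent2_intros =
  convergent2_add convergent2_mult convergent2_deriv_X convergent2_deriv_Y convergent2_const2
  convergent2_0 convergent2_1 convergent2_uminus convergent2_diff convergent2_prod

text \<open>Writes g = g(0,0) + X p + Y h, with all pure powers of X put into p. Shifting an index
  by one costs a factor \<open>A\<close> in the coefficient bound, so p and h converge. The value of
  g on a branch can then be computed from those of X and Y.\<close>

lemma convergent2_split:
  assumes "convergent2 g"
  obtains p h where "convergent2 p" "convergent2 h"
    "g = const2 (fps_nth (fps_nth g 0) 0) + fps_const fps_X * p + fps_X * h"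
proof -
  obtain A C where 1: "A \<ge> 1" "C \<ge> 0" "\<And>i j. norm (fps_nth (fps_nth g j) i) \<le> C * A ^ (i + j)"
    by (rule convergent2E[OF assms(1)]) (rule that)
  define p where "p = fps_const (fps_shift 1 (fps_nth g 0))"
  define h where "h = fps_shift 1 g"
  have "convergent2 p"
  proof (rule convergent2I)
    fix i j show "norm (fps_nth (fps_nth p j) i) \<le> (C * A) * A ^ (i + j)"
      using 1(1,2) 1(3)[of 0 "Suc i"] unfolding p_def by (auto simp: mult.assoc)
  qed (rule 1)
  moreover have "convergent2 h"
  proof (rule convergent2I)
    fix i j show "norm (fps_nth (fps_nth h j) i) \<le> (C * A) * A ^ (i + j)"
      using 1(1,2) 1(3)[of "Suc j" i] unfolding h_def by (auto simp: mult.assoc)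
  qed (rule 1)
  moreover have "g = const2 (fps_nth (fps_nth g 0) 0) + fps_const fps_X * p + fps_X * h"
  proof (intro fps_ext)
    fix j i
    show "fps_nth (fps_nth g j) i =
        fps_nth (fps_nth (const2 (fps_nth (fps_nth g 0) 0) + fps_const fps_X * p + fps_X * h) j) i"
      unfolding const2_def p_def h_def by (cases j; cases i) simp_all
  qed
  ultimately show ?thesis using that by blast
qed

section \<open>The commutative ring C{X,Y}\<close>

lemma CXY_simps [simp]:
  "carrier CXY = Collect convergent2" "mult CXY = (*)" "one CXY = 1" "ring.zero CXY = 0" "add CXY = (+)"
  by (simp_all add: CXY_def)

lemma cring_CXY: "cring CXY"
proof (rule cringI)
  show "abelian_group CXY"
  proof (rule abelian_groupI)
    fix x assume "x \<in> carrier CXY"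
    then show "\<exists>y\<in>carrier CXY. y \<oplus>\<^bsub>CXY\<^esub> x = \<zero>\<^bsub>CXY\<^esub>"
      by (intro bexI[of _ "- x"]) (auto intro: convergent2_intros)
  qed (auto intro: convergent2_intros)
  show "comm_monoid CXY"
    by (rule comm_monoidI) (auto intro: convergent2_intros)
qed (auto simp: algebra_simps)

section \<open>Finiteness of \<open>\<complex>{t}\<close> over a subring and the conductor\<close>

abbreviation convergent1 :: "complex fps \<Rightarrow> bool" where
  "convergent1 p \<equiv> fps_conv_radius p > 0"

lemma convergent1_add: "convergent1 p \<Longrightarrow> convergent1 q \<Longrightarrow> convergent1 (p + q)"
  by (rule less_le_trans[OF _ fps_conv_radius_add]) simp

lemma convergent1_mult: "convergent1 p \<Longrightarrow> convergent1 q \<Longrightarrow> convergent1 (p * q)"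
  by (rule less_le_trans[OF _ fps_conv_radius_mult]) simp

lemma convergent1_diff: "convergent1 p \<Longrightarrow> convergent1 q \<Longrightarrow> convergent1 (p - q)"
  by (rule less_le_trans[OF _ fps_conv_radius_diff]) simp

lemma convergent1_power: "convergent1 p \<Longrightarrow> convergent1 (p ^ n)"
  by (rule less_le_trans[OF _ fps_conv_radius_power])

lemma convergent1_iff: "convergent1 p \<longleftrightarrow> eval_fps p has_fps_expansion p"
  by (simp add: has_fps_expansion_def)

lemma convergent1_compose: "convergent1 p \<Longrightarrow> convergent1 q \<Longrightarrow> fps_nth q 0 = 0 \<Longrightarrow> convergent1 (p oo q)"
  using has_fps_expansion_compose[of "eval_fps p" p "eval_fps q" q]
  by (auto simp: has_fps_expansion_def)

lemma convergent1I:
  assumes "\<And>n. norm (fps_nth p n) \<le> C * A ^ n" "A > 0"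
  shows "convergent1 p"
proof -
  have "summable (\<lambda>n. fps_nth p n * of_real (1 / (2 * A)) ^ n)"
  proof (rule summable_comparison_test)
    show "\<exists>N. \<forall>n\<ge>N. norm (fps_nth p n * of_real (1 / (2 * A)) ^ n) \<le> C * (1 / 2) ^ n"
    proof (intro exI allI impI)
      fix n
      have "norm (fps_nth p n * of_real (1 / (2 * A)) ^ n) = norm (fps_nth p n) * (1 / (2 * A)) ^ n"
        using assms(2) by (simp add: norm_mult norm_power norm_divide)
      also have "\<dots> \<le> (C * A ^ n) * (1 / (2 * A)) ^ n"
        using assms by (intro mult_right_mono) auto
      also have "\<dots> = C * (1 / 2) ^ n" using assms(2) by (simp add: field_simps)
      finally show "norm (fps_nth p n * of_real (1 / (2 * A)) ^ n) \<le> C * (1 / 2) ^ n" .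
    qed
  qed (intro summable_mult summable_geometric, simp)
  from conv_radius_geI[OF this] have "fps_conv_radius p \<ge> ereal (1 / (2 * A))"
    using assms(2) by (simp add: fps_conv_radius_def norm_divide)
  moreover have "0 < ereal (1 / (2 * A))" using assms(2) by simp
  ultimately show ?thesis by (rule less_le_trans[rotated])
qed

text \<open>Writing u = u(0) (1 + w) with w(0) = 0, a root is a complex root of u(0) times the
  binomial series of exponent 1/n evaluated at w.\<close>

lemma convergent1_nth_root:
  assumes "convergent1 u" "fps_nth u 0 \<noteq> 0" "n > 0"
  obtains v where "convergent1 v" "fps_nth v 0 \<noteq> 0" "v ^ n = u"
proof -
  obtain c where c: "fps_nth u 0 = c ^ n"
    using assms(3) exists_complex_root[of n "fps_nth u 0"] by blast
  have c0: "c \<noteq> 0" using c assms by (auto simp: power_0_left)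
  define w where "w = fps_const (inverse (fps_nth u 0)) * u - 1"
  have w: "convergent1 w" "fps_nth w 0 = 0" using assms unfolding w_def
    by (auto intro!: convergent1_diff convergent1_mult)
  define b :: "complex fps" where "b = fps_binomial (1 / of_nat n)"
  have b: "convergent1 b" "fps_nth b 0 = 1" "b ^ n = 1 + fps_X"
    using has_fps_expansion_binomial_complex[of "1 / of_nat n"] assms(3)
    by (auto simp: b_def has_fps_expansion_def fps_binomial_power fps_binomial_1)
  define v where "v = fps_const c * (b oo w)"
  have "convergent1 v" unfolding v_def by (intro convergent1_mult convergent1_compose b w) simp
  moreover have "fps_nth v 0 \<noteq> 0" using c0 b unfolding v_def by simp
  moreover have "v ^ n = u"
  proof -
    have "v ^ n = fps_const (fps_nth u 0) * (1 + w)"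
      unfolding v_def power_mult_distrib fps_compose_power[OF w(2)] b fps_compose_add_distrib
      using w(2) fps_X_power_compose[OF w(2), of 1] c by (simp add: fps_const_power)
    also have "\<dots> = u" using assms unfolding w_def by (simp add: mult.assoc[symmetric])
    finally show ?thesis .
  qed
  ultimately show ?thesis using that by blast
qed

text \<open>The sum of \<open>s\<close> has nonzero derivative at 0, so it is injective near 0 with
  a holomorphic local inverse; \<open>h\<close> is the expansion of that inverse.\<close>

lemma convergent1_inverse_compose:
  assumes "convergent1 s" "fps_nth s 0 = 0" "fps_nth s 1 \<noteq> 0"
  obtains h where "convergent1 h" "fps_nth h 0 = 0" "h oo s = fps_X"
proof -
  define f where "f = eval_fps s"
  have f: "f has_fps_expansion s" using assms convergent1_iff f_def by simp
  have f0: "f 0 = 0" using assms by (simp add: f_def eval_fps_at_0)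
  obtain S where S: "open S" "0 \<in> S" "f holomorphic_on S"
    by (rule has_fps_expansion_imp_holomorphic[OF f]) (rule that)
  have "deriv f 0 \<noteq> 0"
    using fps_nth_fps_expansion[OF f, of 1] assms by simp
  then obtain r where r: "r > 0" "ball 0 r \<subseteq> S" "open (f ` ball 0 r)" "inj_on f (ball 0 r)"
    using has_complex_derivative_locally_invertible[OF S(3,2,1)] by metis
  obtain g where g: "g holomorphic_on (f ` ball 0 r)" "\<And>z. z \<in> ball 0 r \<Longrightarrow> g (f z) = z"
    by (rule holomorphic_has_inverse[OF holomorphic_on_subset[OF S(3) r(2)] open_ball r(4)]) (rule that)
  have "0 \<in> f ` ball 0 r" using f0 r by (intro image_eqI[of _ _ 0]) auto
  then have h: "g has_fps_expansion fps_expansion g 0" (is "_ has_fps_expansion ?h")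
    using g r by (intro has_fps_expansion_fps_expansion) auto
  have "g 0 = 0" using g(2)[of 0] f0 r by simp
  then have h0: "fps_nth ?h 0 = 0" using has_fps_expansion_imp_0_eq_fps_nth_0[OF h] by simp
  have "(g \<circ> f) has_fps_expansion (?h oo s)"
    using has_fps_expansion_compose[OF h f assms(2)] .
  moreover have "eventually (\<lambda>z. z \<in> ball 0 r) (nhds 0)"
    using r by (intro eventually_nhds_in_open) auto
  then have "eventually (\<lambda>z. (g \<circ> f) z = z) (nhds 0)"
    by (rule eventually_mono) (use g in auto)
  ultimately have "(\<lambda>z. z) has_fps_expansion (?h oo s)"
    using has_fps_expansion_cong[of "g \<circ> f" "\<lambda>z. z" "?h oo s" "?h oo s"] by simp
  then have "?h oo s = fps_X"
    by (rule fps_expansion_unique_complex[OF _ has_fps_expansion_fps_X])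
  moreover have "convergent1 ?h" using h by (simp add: has_fps_expansion_def)
  ultimately show ?thesis using that h0 by blast
qed

lemma convergent1_section:
  assumes "convergent1 q" "n > 0"
  shows "convergent1 (Abs_fps (\<lambda>m. fps_nth q (m * n + k)))"
proof -
  obtain C A where CA: "A \<ge> 1" "C \<ge> 0" "\<And>n. norm (fps_nth q n) \<le> C * A ^ n"
    using assms(1) by (rule fps_conv_radius_pos_bound) (rule that)
  show ?thesis
  proof (rule convergent1I)
    fix m show "norm (fps_nth (Abs_fps (\<lambda>m. fps_nth q (m * n + k))) m) \<le> (C * A ^ k) * (A ^ n) ^ m"
      using CA(3)[of "m * n + k"] by (simp add: power_add power_mult[symmetric] mult_ac)
  qed (use CA in simp)
qed

text \<open>The exponents of \<open>q\<close> are sorted by their residue modulo \<open>n\<close>,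
  each one being written as m n + k with k < n.\<close>

lemma fps_sections:
  fixes q :: "'a :: idom fps"
  assumes "n > 0"
  shows "q = (\<Sum>k<n. fps_X ^ k * (Abs_fps (\<lambda>m. fps_nth q (m * n + k)) oo fps_X ^ n))"
proof (intro fps_ext)
  fix i
  have "fps_nth (fps_X ^ k * (Abs_fps (\<lambda>m. fps_nth q (m * n + k)) oo fps_X ^ n)) i
     = (if k = i mod n then fps_nth q i else 0)" if "k < n" for k
  proof (cases "k \<le> i \<and> n dvd (i - k)")
    case True
    then have "k = i mod n" using that by (metis mod_eq_dvd_iff_nat mod_less)
    have "(i - k) div n * n + k = i" using True by simp
    moreover have "\<not> i < k" using True by simp
    ultimately have "fps_nth (fps_X ^ k * (Abs_fps (\<lambda>m. fps_nth q (m * n + k)) oo fps_X ^ n)) i = fps_nth q i"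
      using True by (simp add: fps_X_power_mult_nth fps_nth_compose_X_power)
    then show ?thesis using \<open>k = i mod n\<close> by simp
  next
    case False
    then have "k \<noteq> i mod n" by (auto simp: minus_mod_eq_mult_div)
    then show ?thesis using False assms
      by (auto simp: fps_X_power_mult_nth fps_nth_compose_X_power)
  qed
  then have "fps_nth (\<Sum>k<n. fps_X ^ k * (Abs_fps (\<lambda>m. fps_nth q (m * n + k)) oo fps_X ^ n)) i
    = (\<Sum>k<n. if k = i mod n then fps_nth q i else 0)"
    by (simp add: fps_sum_nth)
  also have "\<dots> = fps_nth q i" using assms by (simp add: sum.delta)
  finally show "fps_nth q i = fps_nth (\<Sum>k<n. fps_X ^ k * (Abs_fps (\<lambda>m. fps_nth q (m * n + k)) oo fps_X ^ n)) i" ..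
qed

text \<open>After a change of parameter \<open>x\<close> becomes a pure power: x = t^n u with u a
  unit, so x = s^n for s = t v with v^n = u. Rewriting a series in \<open>s\<close> and sorting
  exponents modulo \<open>n\<close> shows that 1, s, ..., s^(n-1) generate C{t} over C{x}.\<close>

lemma convergent1_finite_over_subring:
  assumes "convergent1 x" "x \<noteq> 0" "fps_nth x 0 = 0"
  obtains s and n :: nat where "convergent1 s"
    "\<And>p. convergent1 p \<Longrightarrow> \<exists>\<phi>. (\<forall>k. convergent1 (\<phi> k)) \<and> p = (\<Sum>k<n. s ^ k * (\<phi> k oo x))"
proof -
  define n where "n = subdegree x"
  have n: "n > 0" using assms nth_subdegree_nonzero[of x] unfolding n_def by (cases "subdegree x = 0") auto
  have u: "convergent1 (fps_shift n x)" "fps_nth (fps_shift n x) 0 \<noteq> 0"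
    using assms by (simp_all add: n_def)
  obtain v where v: "convergent1 v" "fps_nth v 0 \<noteq> 0" "v ^ n = fps_shift n x"
    using convergent1_nth_root[OF u n] .
  define s where "s = fps_X * v"
  have s: "convergent1 s" "fps_nth s 0 = 0" "fps_nth s 1 \<noteq> 0"
    using v by (simp_all add: s_def convergent1_mult)
  have sn: "s ^ n = x"
    unfolding s_def power_mult_distrib v(3)
    unfolding n_def by (subst mult.commute) (rule subdegree_decompose[symmetric])
  obtain h where h: "convergent1 h" "fps_nth h 0 = 0" "h oo s = fps_X"
    using convergent1_inverse_compose[OF s] .
  show ?thesis
  proof (rule that[of s n])
    fix p :: "complex fps" assume p: "convergent1 p"
    define q where "q = p oo h"
    have q: "convergent1 q" unfolding q_def by (intro convergent1_compose p h)
    define \<phi> where "\<phi> k = Abs_fps (\<lambda>m. fps_nth q (m * n + k))" for k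
    have conv: "convergent1 (\<phi> k)" for k
      unfolding \<phi>_def by (rule convergent1_section[OF q n])
    have "p = q oo s"
      unfolding q_def using fps_compose_assoc[OF s(2) h(2), of p] h(3) by simp
    also have "\<dots> = (\<Sum>k<n. fps_X ^ k * (\<phi> k oo fps_X ^ n)) oo s"
      unfolding \<phi>_def using fps_sections[OF n, of q] by simp
    also have "\<dots> = (\<Sum>k<n. s ^ k * (\<phi> k oo x))"
    proof -
      have "(\<phi> k oo fps_X ^ n) oo s = \<phi> k oo x" for k
        using fps_compose_assoc[OF s(2), of "fps_X ^ n" "\<phi> k"] n sn fps_X_power_compose[OF s(2)]
        by simp
      then show ?thesis
        unfolding fps_compose_sum_distrib fps_compose_mult_distrib[OF s(2)] fps_X_power_compose[OF s(2)]
        by simp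
    qed
    finally show "\<exists>\<phi>. (\<forall>k. convergent1 (\<phi> k)) \<and> p = (\<Sum>k<n. s ^ k * (\<phi> k oo x))"
      using conv by blast
  qed (rule s)
qed

text \<open>An algebra homomorphism between rings of convergent series is automatically continuous for the
  adic topology, because \<open>\<theta>(t\<^sup>m p)\<close> is divisible by \<open>x\<^sup>m\<close>.\<close>

lemma alg_hom_eq_compose:
  fixes \<theta> :: "complex fps \<Rightarrow> complex fps"
  assumes add: "\<And>p q. convergent1 p \<Longrightarrow> convergent1 q \<Longrightarrow> \<theta> (p + q) = \<theta> p + \<theta> q"
    and mult: "\<And>p q. convergent1 p \<Longrightarrow> convergent1 q \<Longrightarrow> \<theta> (p * q) = \<theta> p * \<theta> q"
    and const: "\<And>c. \<theta> (fps_const c) = fps_const c"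
    and X: "\<theta> fps_X = x" and x0: "fps_nth x 0 = 0" and p: "convergent1 p"
  shows "\<theta> p = p oo x"
proof -
  have "\<forall>i<m. fps_nth (\<theta> p) i = fps_nth (p oo x) i" for m
    using p
  proof (induction m arbitrary: p)
    case 0
    then show ?case by simp
  next
    case (Suc m)
    define q where "q = fps_shift 1 p"
    have q: "convergent1 q" using Suc unfolding q_def by simp
    have pq: "p = fps_const (fps_nth p 0) + fps_X * q"
    proof (intro fps_ext)
      fix i show "fps_nth p i = fps_nth (fps_const (fps_nth p 0) + fps_X * q) i"
        unfolding q_def by (cases i) simp_all
    qed
    have \<theta>: "\<theta> p = fps_const (fps_nth p 0) + x * \<theta> q"
      using q by (subst pq) (simp add: add mult const X convergent1_mult)
    have c: "p oo x = fps_const (fps_nth p 0) + x * (q oo x)"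
      using fps_X_power_compose[OF x0, of 1]
      by (subst pq) (simp add: fps_compose_add_distrib fps_compose_mult_distrib[OF x0])
    \<comment> \<open>Since \<open>x\<close> has no constant term, the coefficient of index
      \<open>i\<close> only involves coefficients of \<open>\<theta> q\<close> of smaller index,
      where the induction hypothesis applies.\<close>
    have "fps_nth (x * \<theta> q) i = fps_nth (x * (q oo x)) i" if "i < Suc m" for i
    proof -
      have "fps_nth x k * fps_nth (\<theta> q) (i - k) = fps_nth x k * fps_nth (q oo x) (i - k)" if "k \<le> i" for k
        using Suc.IH[OF q] x0 that \<open>i < Suc m\<close> by (cases "k = 0") auto
      then show ?thesis unfolding fps_mult_nth by (intro sum.cong) auto
    qed
    then show ?case using \<theta> c by simp
  qed
  then show ?thesis by (intro fps_ext) blast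
qed

section \<open>Division in C{t} and the conductor\<close>

lemma Ct_iff: "z \<in> Ct \<longleftrightarrow> (\<exists>p. convergent1 p \<and> z = fps_to_fls p)"
  unfolding Ct_def by auto

lemma Ct_mult: "a \<in> Ct \<Longrightarrow> b \<in> Ct \<Longrightarrow> a * b \<in> Ct"
  unfolding Ct_iff by (metis convergent1_mult fls_times_fps_to_fls)

lemma Ct_subset_Kt: "Ct \<subseteq> carrier Kt"
  unfolding Ct_def Kt_def fls_conv_radius_def by auto

text \<open>C{t} is a valuation ring: once the power of t in \<open>b\<close> is removed, what
  remains of \<open>b\<close> is a unit with convergent inverse.\<close>

lemma Ct_divide:
  assumes "a \<in> Ct" "b \<in> Ct" "b \<noteq> 0" "t_order b \<le> t_order a"
  obtains q where "q \<in> Ct" "a = b * q"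
proof -
  obtain v where v: "a = fps_to_fls v" "convergent1 v" using assms(1) unfolding Ct_def by auto
  obtain w where w: "b = fps_to_fls w" "convergent1 w" using assms(2) unfolding Ct_def by auto
  define m where "m = subdegree w"
  have w0: "w \<noteq> 0" using w assms by auto
  define q where "q = fps_shift m v * inverse (fps_shift m w)"
  have "convergent1 q" unfolding q_def using v w w0
    by (intro convergent1_mult fps_conv_radius_inverse_pos) (auto simp: m_def)
  moreover have "v = w * q"
  proof -
    have "m \<le> subdegree v" if "v \<noteq> 0"
      using assms(4) v w w0 that unfolding t_order_def m_def
      by (simp add: fls_subdegree_fls_to_fps)
    then have v': "v = fps_X ^ m * fps_shift m v"
      by (cases "v = 0") (auto intro: trans[OF subdegree_decompose' mult.commute])
    have w': "w = fps_X ^ m * fps_shift m w"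
      unfolding m_def by (subst mult.commute) (rule subdegree_decompose)
    have "fps_shift m w * inverse (fps_shift m w) = 1"
      using w0 by (simp add: m_def inverse_mult_eq_1')
    then have "fps_X ^ m * fps_shift m w * q = fps_X ^ m * fps_shift m v"
      unfolding q_def by (metis mult.assoc mult.commute mult.left_neutral)
    then show ?thesis using v' w' by simp
  qed
  then have "a = b * fps_to_fls q" using v w by (simp add: fls_times_fps_to_fls)
  ultimately show ?thesis
    using that[of "fps_to_fls q"] by (auto simp: Ct_def)
qed

text \<open>The conductor is non-zero: \<open>\<complex>{t}\<close> is a finite module over \<open>\<complex>{x}\<close>, and the denominators of its
  generators can be cleared.\<close>

lemma conductor_exists:
  assumes A: "A \<subseteq> Ct" and A_add: "\<And>a b. a \<in> A \<Longrightarrow> b \<in> A \<Longrightarrow> a + b \<in> A" and A0: "0 \<in> A" and A1: "1 \<in> A"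
    and A_mult: "\<And>a b. a \<in> A \<Longrightarrow> b \<in> A \<Longrightarrow> a * b \<in> A"
    and frac: "\<And>z. z \<in> carrier Kt \<Longrightarrow> \<exists>a\<in>A. \<exists>b\<in>A. b \<noteq> 0 \<and> z = a / b"
    and x: "convergent1 x" "x \<noteq> 0" "fps_nth x 0 = 0"
    and comp: "\<And>p. convergent1 p \<Longrightarrow> fps_to_fls (p oo x) \<in> A"
  obtains b where "b \<in> A" "b \<noteq> 0" "\<And>z. z \<in> Ct \<Longrightarrow> b * z \<in> A"
proof -
  obtain s and n :: nat where s: "convergent1 s" and fin:
    "\<And>p. convergent1 p \<Longrightarrow> \<exists>\<phi>. (\<forall>k. convergent1 (\<phi> k)) \<and> p = (\<Sum>k<n. s ^ k * (\<phi> k oo x))"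
    by (rule convergent1_finite_over_subring[OF x]) (rule that)
  define S where "S = fps_to_fls s"
  have "S ^ k \<in> Ct" for k
    using convergent1_power[OF s] unfolding Ct_def S_def by (auto simp flip: fps_to_fls_power)
  then have "S ^ k \<in> carrier Kt" for k using Ct_subset_Kt by auto
  then have "\<exists>b. b \<in> A \<and> b \<noteq> 0 \<and> b * S ^ k \<in> A" for k
    using frac[of "S ^ k"] by auto
  then obtain d where d: "\<And>k. d k \<in> A" "\<And>k. d k \<noteq> 0" "\<And>k. d k * S ^ k \<in> A"
    by metis
  have prod_A: "prod d K \<in> A" if "finite K" for K
    using that by (induction K) (auto intro: A1 A_mult d)
  define b where "b = prod d {..<n}"
  have bS: "b * S ^ k \<in> A" if "k < n" for k
  proof -
    have "b = d k * prod d ({..<n} - {k})" unfolding b_def using that by (simp add: prod.remove)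
    then have eq: "b * S ^ k = prod d ({..<n} - {k}) * (d k * S ^ k)" by (simp add: mult_ac)
    show ?thesis unfolding eq by (intro A_mult prod_A d) simp
  qed
  have sum_A: "sum g K \<in> A" if "finite K" "\<And>k. k \<in> K \<Longrightarrow> g k \<in> A" for g and K :: "nat set"
    using that by (induction K) (auto intro: A0 A_add)
  show ?thesis
  proof (rule that)
    show "b \<in> A" "b \<noteq> 0" using prod_A d unfolding b_def by auto
    fix z assume "z \<in> Ct"
    then obtain p where p: "z = fps_to_fls p" "convergent1 p" unfolding Ct_def by auto
    then obtain \<phi> where \<phi>: "\<And>k. convergent1 (\<phi> k)" "p = (\<Sum>k<n. s ^ k * (\<phi> k oo x))"
      using fin by blast
    have fls_sum: "fps_to_fls (sum g K) = (\<Sum>k\<in>K. fps_to_fls (g k))" for g :: "nat \<Rightarrow> complex fps" and K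
      by (induction K rule: infinite_finite_induct) auto
    have "b * z = (\<Sum>k<n. (b * S ^ k) * fps_to_fls (\<phi> k oo x))"
      unfolding p \<phi>(2) fls_sum S_def
      by (simp add: fls_times_fps_to_fls fps_to_fls_power sum_distrib_left mult.assoc)
    also have "\<dots> \<in> A" by (intro sum_A A_mult bS comp \<phi>) auto
    finally show "b * z \<in> A" .
  qed
qed

section \<open>Ideals and quotient dimensions\<close>

text \<open>The ambient space consists of all formal double series, so that C{X,Y} and each of its
  ideals are subspaces of the same vector space.\<close>

interpretation fps2: codim_space "\<lambda>c g. const2 c * g"
  by unfold_locales (simp_all add: algebra_simps)

abbreviation conv_ring :: "complex fps fps set" where
  "conv_ring \<equiv> Collect convergent2"

text \<open>Ideals of \<open>CXY\<close> as plain sets of series under the type-class operations, so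
  that \<open>+\<close> on sets is the sum of ideals. Closure under negation follows from
  multiplication by the constant -1.\<close>

definition conv_ideal :: "complex fps fps set \<Rightarrow> bool" where
  "conv_ideal J \<longleftrightarrow> J \<subseteq> conv_ring \<and> 0 \<in> J \<and> (\<forall>a\<in>J. \<forall>b\<in>J. a + b \<in> J) \<and>
     (\<forall>c\<in>conv_ring. \<forall>a\<in>J. c * a \<in> J)"

lemma conv_idealI:
  assumes "\<And>a. a \<in> J \<Longrightarrow> convergent2 a" "0 \<in> J" "\<And>a b. a \<in> J \<Longrightarrow> b \<in> J \<Longrightarrow> a + b \<in> J"
    "\<And>c a. convergent2 c \<Longrightarrow> a \<in> J \<Longrightarrow> c * a \<in> J"
  shows "conv_ideal J"
  using assms unfolding conv_ideal_def by auto

lemma conv_idealD: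
  assumes "conv_ideal J"
  shows "\<And>a. a \<in> J \<Longrightarrow> convergent2 a" "0 \<in> J" "\<And>a b. a \<in> J \<Longrightarrow> b \<in> J \<Longrightarrow> a + b \<in> J"
    "\<And>c a. convergent2 c \<Longrightarrow> a \<in> J \<Longrightarrow> c * a \<in> J"
    "\<And>a. a \<in> J \<Longrightarrow> - a \<in> J" "\<And>a b. a \<in> J \<Longrightarrow> b \<in> J \<Longrightarrow> a - b \<in> J"
proof -
  show *: "\<And>a. a \<in> J \<Longrightarrow> convergent2 a" "0 \<in> J" "\<And>a b. a \<in> J \<Longrightarrow> b \<in> J \<Longrightarrow> a + b \<in> J"
    "\<And>c a. convergent2 c \<Longrightarrow> a \<in> J \<Longrightarrow> c * a \<in> J"
    using assms unfolding conv_ideal_def by auto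
  show neg: "- a \<in> J" if "a \<in> J" for a
    using *(4)[OF convergent2_const2[of "-1"] that] by simp
  show "a - b \<in> J" if "a \<in> J" "b \<in> J" for a b
    using *(3)[OF that(1) neg[OF that(2)]] by simp
qed

lemma conv_ideal_subspace: "conv_ideal J \<Longrightarrow> fps2.subspace J"
  by (intro fps2.subspaceI) (auto dest: conv_idealD intro: convergent2_const2)

lemma conv_ideal_ring: "conv_ideal conv_ring"
  by (intro conv_idealI) (auto intro: convergent2_intros)

lemma conv_ideal_Int: "conv_ideal J \<Longrightarrow> conv_ideal K \<Longrightarrow> conv_ideal (J \<inter> K)"
  unfolding conv_ideal_def by auto

lemma conv_ideal_plus:
  assumes J: "conv_ideal J" and K: "conv_ideal K" shows "conv_ideal (J + K)"
proof (rule conv_idealI)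
  show "convergent2 a" if "a \<in> J + K" for a
    using that conv_idealD(1)[OF J] conv_idealD(1)[OF K] by (auto elim!: set_plus_elim intro: convergent2_add)
  show "0 \<in> J + K" using set_plus_intro[OF conv_idealD(2)[OF J] conv_idealD(2)[OF K]] by simp
  show "a + b \<in> J + K" if sum: "a \<in> J + K" "b \<in> J + K" for a b
  proof -
    obtain j k where a: "a = j + k" "j \<in> J" "k \<in> K" using sum(1) by (auto elim: set_plus_elim)
    obtain j' k' where b: "b = j' + k'" "j' \<in> J" "k' \<in> K" using sum(2) by (auto elim: set_plus_elim)
    have "a + b = (j + j') + (k + k')" using a b by simp
    then show ?thesis using a b conv_idealD(3)[OF J] conv_idealD(3)[OF K] by (metis set_plus_intro)
  qed
  show "c * a \<in> J + K" if "convergent2 c" "a \<in> J + K" for c a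
    using that conv_idealD(4)[OF J] conv_idealD(4)[OF K]
    by (auto elim!: set_plus_elim intro!: set_plus_intro simp: distrib_left)
qed

lemma conv_ideal_plus_superset:
  assumes "conv_ideal J" "conv_ideal K" shows "J \<subseteq> J + K" "K \<subseteq> J + K"
proof -
  note 0 = conv_idealD(2)[OF assms(1)] conv_idealD(2)[OF assms(2)]
  show "J \<subseteq> J + K" using set_plus_intro[OF _ 0(2), of _ J] by auto
  show "K \<subseteq> J + K" using set_plus_intro[OF 0(1), of _ K] by auto
qed

lemma conv_ideal_plus_least:
  assumes "conv_ideal L" "J \<subseteq> L" "K \<subseteq> L" shows "J + K \<subseteq> L"
  using assms conv_idealD(3)[OF assms(1)] by (auto elim!: set_plus_elim)

lemma conv_ideal_plus_absorb:
  assumes "conv_ideal J" "conv_ideal K" "J \<subseteq> K" shows "J + K = K"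
  using conv_ideal_plus_least[OF assms(2,3)] conv_ideal_plus_superset[OF assms(1,2)] by auto

text \<open>The cofactor has to converge as well, so this is the principal ideal in C{X,Y} and not
  in the formal series.\<close>

definition multiples :: "complex fps fps \<Rightarrow> complex fps fps set" where
  "multiples g = {a * g | a. convergent2 a}"

lemma conv_ideal_multiples: "convergent2 g \<Longrightarrow> conv_ideal (multiples g)"
  unfolding multiples_def
proof (intro conv_idealI, goal_cases)
  case (2)
  then show ?case using convergent2_0 by force
next
  case (3 a b)
  then show ?case using convergent2_add by (auto simp flip: distrib_right)
next
  case (4 c a)
  then show ?case using convergent2_mult by (auto simp flip: mult.assoc)
qed (auto intro: convergent2_intros)

lemma multiples_self: "g \<in> multiples g"
  unfolding multiples_def using convergent2_1 by force

lemma multiples_subset_iff: "conv_ideal J \<Longrightarrow> multiples g \<subseteq> J \<longleftrightarrow> g \<in> J"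
  using multiples_self[of g] conv_idealD(4)[of J] unfolding multiples_def by auto

section \<open>Translation of ideals, cosets and quotient rings of C{X,Y}\<close>

lemma ring_CXY: "ring CXY"
  using cring_CXY by (rule cring.axioms)

lemma a_inv_CXY: "convergent2 x \<Longrightarrow> a_inv CXY x = - x"
  using abelian_group.minus_equality[OF ring.is_abelian_group[OF ring_CXY], of "- x" x]
  by (simp add: convergent2_uminus)

lemma ideal_CXY_iff: "ideal J CXY \<longleftrightarrow> conv_ideal J"
proof
  assume J: "ideal J CXY"
  then have J': "additive_subgroup J CXY" by (rule ideal.axioms)
  show "conv_ideal J"
  proof (rule conv_idealI)
    show "convergent2 a" if "a \<in> J" for a
      using additive_subgroup.a_subset[OF J'] that by auto
    show "0 \<in> J" using additive_subgroup.zero_closed[OF J'] by simp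
    show "a + b \<in> J" if "a \<in> J" "b \<in> J" for a b
      using additive_subgroup.a_closed[OF J' that] by simp
    show "c * a \<in> J" if "convergent2 c" "a \<in> J" for c a
      using ideal.I_l_closed[OF J, of a c] that by simp
  qed
next
  assume J: "conv_ideal J"
  show "ideal J CXY"
  proof (rule idealI[OF ring_CXY])
    show "subgroup J (add_monoid CXY)"
    proof (rule subgroup.intro)
      show "inv\<^bsub>add_monoid CXY\<^esub> x \<in> J" if "x \<in> J" for x
        using a_inv_CXY[of x] conv_idealD[OF J] that unfolding a_inv_def by simp
    qed (use conv_idealD[OF J] in auto)
    show "x \<otimes>\<^bsub>CXY\<^esub> a \<in> J" "a \<otimes>\<^bsub>CXY\<^esub> x \<in> J" if "a \<in> J" "x \<in> carrier CXY" for a x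
      using conv_idealD(4)[OF J, of x a] that by (simp_all add: mult.commute)
  qed
qed

lemma PIdl_CXY: "PIdl\<^bsub>CXY\<^esub> g = multiples g"
  unfolding cgenideal_def multiples_def by simp

lemma Idl_CXY_eqI:
  assumes "conv_ideal J" "S \<subseteq> J" "\<And>K. conv_ideal K \<Longrightarrow> S \<subseteq> K \<Longrightarrow> J \<subseteq> K"
  shows "Idl\<^bsub>CXY\<^esub> S = J"
  unfolding genideal_def ideal_CXY_iff using assms by auto

lemma Idl2_CXY:
  assumes "convergent2 g" "convergent2 h"
  shows "Idl\<^bsub>CXY\<^esub> {g, h} = multiples g + multiples h"
proof (rule Idl_CXY_eqI)
  note I = conv_ideal_multiples[OF assms(1)] conv_ideal_multiples[OF assms(2)]
  show "conv_ideal (multiples g + multiples h)" by (intro conv_ideal_plus I)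
  show "{g, h} \<subseteq> multiples g + multiples h"
    using conv_ideal_plus_superset[OF I] multiples_self by auto
  show "multiples g + multiples h \<subseteq> K" if "conv_ideal K" "{g, h} \<subseteq> K" for K
    using that by (intro conv_ideal_plus_least) (simp_all add: multiples_subset_iff)
qed

lemma Idl3_CXY:
  assumes "convergent2 f" "convergent2 g" "convergent2 h"
  shows "Idl\<^bsub>CXY\<^esub> {f, g, h} = multiples f + (multiples g + multiples h)"
proof (rule Idl_CXY_eqI)
  note I = conv_ideal_multiples[OF assms(1)] conv_ideal_multiples[OF assms(2)]
    conv_ideal_multiples[OF assms(3)]
  show "conv_ideal (multiples f + (multiples g + multiples h))" by (intro conv_ideal_plus I)
  show "{f, g, h} \<subseteq> multiples f + (multiples g + multiples h)"
    using conv_ideal_plus_superset[OF I(1) conv_ideal_plus[OF I(2,3)]]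
      conv_ideal_plus_superset[OF I(2,3)] multiples_self by blast
  show "multiples f + (multiples g + multiples h) \<subseteq> K" if "conv_ideal K" "{f, g, h} \<subseteq> K" for K
    using that by (intro conv_ideal_plus_least) (simp_all add: multiples_subset_iff)
qed

lemma coset_CXY: "J +>\<^bsub>CXY\<^esub> g = {x. x - g \<in> J}"
proof -
  have "x \<in> J +>\<^bsub>CXY\<^esub> g \<longleftrightarrow> x - g \<in> J" for x
    unfolding a_r_coset_def' by (auto intro!: bexI[of _ "x - g"])
  then show ?thesis by auto
qed

lemma coset_CXY_eq_iff:
  assumes J: "conv_ideal J"
  shows "J +>\<^bsub>CXY\<^esub> g = J +>\<^bsub>CXY\<^esub> h \<longleftrightarrow> g - h \<in> J"
proof
  assume "J +>\<^bsub>CXY\<^esub> g = J +>\<^bsub>CXY\<^esub> h"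
  moreover have "g \<in> J +>\<^bsub>CXY\<^esub> g" using conv_idealD(2)[OF J] by (simp add: coset_CXY)
  ultimately have "g \<in> J +>\<^bsub>CXY\<^esub> h" by simp
  then show "g - h \<in> J" by (simp add: coset_CXY)
next
  assume *: "g - h \<in> J"
  have "x - g \<in> J \<longleftrightarrow> x - h \<in> J" for x
    using conv_idealD(3)[OF J, of "x - g" "g - h"] conv_idealD(6)[OF J, of "x - h" "g - h"] *
    by auto
  then show "J +>\<^bsub>CXY\<^esub> g = J +>\<^bsub>CXY\<^esub> h" by (simp add: coset_CXY)
qed

lemma carrier_Quot_CXY: "carrier (CXY Quot J) = (\<lambda>g. J +>\<^bsub>CXY\<^esub> g) ` conv_ring"
  unfolding FactRing_def A_RCOSETS_def' by auto

lemma zero_Quot_CXY: "conv_ideal J \<Longrightarrow> \<zero>\<^bsub>CXY Quot J\<^esub> = J +>\<^bsub>CXY\<^esub> 0"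
  unfolding FactRing_def by (simp add: coset_CXY)

lemma add_Quot_CXY:
  assumes J: "conv_ideal J"
  shows "(J +>\<^bsub>CXY\<^esub> g) \<oplus>\<^bsub>CXY Quot J\<^esub> (J +>\<^bsub>CXY\<^esub> h) = J +>\<^bsub>CXY\<^esub> (g + h)"
proof -
  have "x \<in> {a + b | a b. a - g \<in> J \<and> b - h \<in> J} \<longleftrightarrow> x - (g + h) \<in> J" for x
  proof
    assume "x \<in> {a + b | a b. a - g \<in> J \<and> b - h \<in> J}"
    then obtain a b where "x = a + b" "a - g \<in> J" "b - h \<in> J" by auto
    then show "x - (g + h) \<in> J"
      using conv_idealD(3)[OF J, of "a - g" "b - h"] by (simp add: algebra_simps)
  next
    assume "x - (g + h) \<in> J"
    then show "x \<in> {a + b | a b. a - g \<in> J \<and> b - h \<in> J}"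
      using conv_idealD(2)[OF J]
      by (intro CollectI exI[of _ "x - h"] exI[of _ h]) (simp add: algebra_simps)
  qed
  then have "{a + b | a b. a - g \<in> J \<and> b - h \<in> J} = {x. x - (g + h) \<in> J}" by blast
  moreover have "{x. x - g \<in> J} <+>\<^bsub>CXY\<^esub> {x. x - h \<in> J} = {a + b | a b. a - g \<in> J \<and> b - h \<in> J}"
    unfolding set_add_def' by auto
  ultimately show ?thesis unfolding FactRing_def by (simp add: coset_CXY)
qed

lemma mult_Quot_CXY:
  assumes J: "conv_ideal J" and "convergent2 g" "convergent2 h"
  shows "(J +>\<^bsub>CXY\<^esub> g) \<otimes>\<^bsub>CXY Quot J\<^esub> (J +>\<^bsub>CXY\<^esub> h) = J +>\<^bsub>CXY\<^esub> (g * h)"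
  using ideal.rcoset_mult_add[of J CXY g h] assms unfolding FactRing_def by (simp add: ideal_CXY_iff)

text \<open>The bridge between the two inductive notions of dimension: passing to cosets commutes
  with adjoining one vector.\<close>

lemma line_extension_Quot_CXY:
  assumes J: "conv_ideal J" and w: "convergent2 w"
  shows "ring.line_extension (CXY Quot J) (range (\<lambda>c. J +>\<^bsub>CXY\<^esub> const2 c)) (J +>\<^bsub>CXY\<^esub> w)
      ((\<lambda>g. J +>\<^bsub>CXY\<^esub> g) ` E) = (\<lambda>g. J +>\<^bsub>CXY\<^esub> g) ` fps2.adjoin w E"
    (is "?L = ?co ` _")
proof -
  have ring: "ring (CXY Quot J)" by (rule ideal.quotient_is_ring) (simp add: ideal_CXY_iff J)
  have "?L = {?co (const2 c) \<otimes>\<^bsub>CXY Quot J\<^esub> ?co w \<oplus>\<^bsub>CXY Quot J\<^esub> ?co e | c e. e \<in> E}"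
    unfolding ring.line_extension_def[OF ring] r_coset_def set_add_def' by auto
  also have "\<dots> = {?co (const2 c * w + e) | c e. e \<in> E}"
    using J w by (simp add: mult_Quot_CXY add_Quot_CXY convergent2_const2)
  also have "\<dots> = ?co ` {const2 c * w + e | c e. e \<in> E}" by auto
  also have "{const2 c * w + e | c e. e \<in> E} = fps2.adjoin w E"
  proof (intro Set.set_eqI iffI)
    fix x assume "x \<in> {const2 c * w + e | c e. e \<in> E}"
    then obtain c e where "x = const2 c * w + e" "e \<in> E" by auto
    then show "x \<in> fps2.adjoin w E" unfolding fps2.adjoin_def by (intro CollectI exI[of _ c]) simp
  next
    fix x assume "x \<in> fps2.adjoin w E"
    then obtain c where "x - const2 c * w \<in> E" unfolding fps2.adjoin_def by auto
    then show "x \<in> {const2 c * w + e | c e. e \<in> E}"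
      by (intro CollectI exI[of _ c] exI[of _ "x - const2 c * w"]) simp
  qed
  finally show ?thesis .
qed

lemma coset_image_mem_iff:
  assumes J: "conv_ideal J" and E: "fps2.subspace E" "J \<subseteq> E"
  shows "J +>\<^bsub>CXY\<^esub> v \<in> (\<lambda>g. J +>\<^bsub>CXY\<^esub> g) ` E \<longleftrightarrow> v \<in> E"
proof
  assume "J +>\<^bsub>CXY\<^esub> v \<in> (\<lambda>g. J +>\<^bsub>CXY\<^esub> g) ` E"
  then obtain e where "e \<in> E" "v - e \<in> E" using coset_CXY_eq_iff[OF J] E(2) by auto
  then show "v \<in> E" using fps2.subspace_add[OF E(1), of "v - e" e] by simp
qed auto

text \<open>Chains in the quotient and chains from \<open>J\<close> to the whole ring correspond. A
  vector is new in one exactly when it is new in the other, because every member of a chain contains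
  \<open>J\<close> and is therefore a union of cosets.\<close>

lemma dimension_Quot_iff:
  assumes J: "conv_ideal J"
  shows "ring.dimension (CXY Quot J) n (range (\<lambda>c. J +>\<^bsub>CXY\<^esub> const2 c)) (carrier (CXY Quot J))
    \<longleftrightarrow> fps2.codim_is J n conv_ring"
proof -
  let ?co = "\<lambda>g. J +>\<^bsub>CXY\<^esub> g" and ?k = "range (\<lambda>c. J +>\<^bsub>CXY\<^esub> const2 c)"
  have ring: "ring (CXY Quot J)" by (rule ideal.quotient_is_ring) (simp add: ideal_CXY_iff J)
  note sJ = conv_ideal_subspace[OF J] and sR = conv_ideal_subspace[OF conv_ideal_ring]
  have zero: "{\<zero>\<^bsub>CXY Quot J\<^esub>} = ?co ` J"
  proof -
    have "J +>\<^bsub>CXY\<^esub> g = J +>\<^bsub>CXY\<^esub> 0" if "g \<in> J" for g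
      using that coset_CXY_eq_iff[OF J] by simp
    then have "?co ` J \<subseteq> {?co 0}" by (intro image_subsetI) simp
    moreover have "?co 0 \<in> ?co ` J" using conv_idealD(2)[OF J] by (rule imageI)
    ultimately have "?co ` J = {?co 0}" by blast
    then show ?thesis using zero_Quot_CXY[OF J] by simp
  qed
  have push: "ring.dimension (CXY Quot J) n ?k (?co ` E)" if "fps2.codim_is J n E" "E \<subseteq> conv_ring" for n E
    using that
  proof (induction rule: fps2.codim_is.induct)
    case codim_is_0
    show ?case using ring.zero_dim[OF ring, of ?k] unfolding zero .
  next
    case (codim_is_Suc n E v)
    note E = fps2.codim_is_subspace[OF codim_is_Suc(1) sJ] fps2.codim_is_subset[OF codim_is_Suc(1)]
    have EV: "E \<subseteq> conv_ring" "convergent2 v"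
      using codim_is_Suc(4) fps2.adjoin_superset[of E v] fps2.adjoin_self[OF E(1), of v] by auto
    have "ring.dimension (CXY Quot J) (Suc n) ?k (ring.line_extension (CXY Quot J) ?k (?co v) (?co ` E))"
      using EV codim_is_Suc(2,3) coset_image_mem_iff[OF J E]
      by (intro ring.Suc_dim[OF ring]) (auto simp: carrier_Quot_CXY)
    then show ?case by (simp add: line_extension_Quot_CXY[OF J EV(2)])
  qed
  have pull: "\<exists>E. S = ?co ` E \<and> fps2.codim_is J n E \<and> E \<subseteq> conv_ring"
    if "ring.dimension (CXY Quot J) n ?k S" for n S
    using that
  proof (induction n ?k S rule: ring.dimension.induct[OF ring, consumes 1, case_names zero_dim Suc_dim])
    case zero_dim
    then show ?case using zero conv_idealD(1)[OF J] fps2.codim_is_0 by blast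
  next
    case (Suc_dim v S n)
    then obtain E where E: "S = ?co ` E" "fps2.codim_is J n E" "E \<subseteq> conv_ring" by auto
    obtain w where w: "v = ?co w" "convergent2 w" using Suc_dim by (auto simp: carrier_Quot_CXY)
    have "w \<notin> E" using Suc_dim w E by auto
    then have "fps2.codim_is J (Suc n) (fps2.adjoin w E)" using E by (intro fps2.codim_is_Suc)
    moreover have "fps2.adjoin w E \<subseteq> conv_ring" using E w by (intro fps2.adjoin_least[OF sR]) auto
    ultimately show ?case using line_extension_Quot_CXY[OF J w(2), of E] w E by blast
  qed
  show ?thesis
  proof
    assume "ring.dimension (CXY Quot J) n ?k (carrier (CXY Quot J))"
    from pull[OF this] obtain E where
      E: "?co ` conv_ring = ?co ` E" "fps2.codim_is J n E" "E \<subseteq> conv_ring"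
      by (auto simp: carrier_Quot_CXY)
    have "conv_ring \<subseteq> E"
    proof
      fix g assume "g \<in> conv_ring"
      then have "?co g \<in> ?co ` E" unfolding E(1)[symmetric] by (rule imageI)
      then show "g \<in> E"
        using coset_image_mem_iff[OF J fps2.codim_is_subspace[OF E(2) sJ] fps2.codim_is_subset[OF E(2)]]
        by simp
    qed
    then have "E = conv_ring" using E(3) by (rule equalityI[rotated])
    then show "fps2.codim_is J n conv_ring" using E(2) by simp
  qed (use push in \<open>simp add: carrier_Quot_CXY\<close>)
qed

lemma quot_dim_eq_codim:
  assumes J: "conv_ideal J"
  shows "quot_dim J = fps2.codim J conv_ring"
proof -
  have ring: "ring (CXY Quot J)" by (rule ideal.quotient_is_ring) (simp add: ideal_CXY_iff J)
  show ?thesis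
    unfolding quot_dim_def Let_def ring.finite_dimension_def[OF ring] ring.dim_def[OF ring]
      dimension_Quot_iff[OF J] fps2.codim_def by (rule refl)
qed

section \<open>Branches\<close>

text \<open>If the image of t had constant term c \<noteq> 0, then t - c would be a unit of C{t}
  whose image has constant term 0 and hence no inverse.\<close>

lemma alg_hom_X_nth_0:
  fixes \<theta> :: "complex fps \<Rightarrow> complex fps"
  assumes add: "\<And>p q. convergent1 p \<Longrightarrow> convergent1 q \<Longrightarrow> \<theta> (p + q) = \<theta> p + \<theta> q"
    and mult: "\<And>p q. convergent1 p \<Longrightarrow> convergent1 q \<Longrightarrow> \<theta> (p * q) = \<theta> p * \<theta> q"
    and const: "\<And>c. \<theta> (fps_const c) = fps_const c"
  shows "fps_nth (\<theta> fps_X) 0 = 0"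
proof (rule ccontr)
  define c where "c = fps_nth (\<theta> fps_X) 0"
  assume "fps_nth (\<theta> fps_X) 0 \<noteq> 0"
  then have c: "c \<noteq> 0" by (simp add: c_def)
  define u where "u = fps_X + fps_const (- c)"
  have u: "convergent1 u" "fps_nth u 0 \<noteq> 0"
    using c unfolding u_def by (auto intro!: convergent1_add simp del: fps_const_neg)
  then have inv: "convergent1 (inverse u)" by (intro fps_conv_radius_inverse_pos)
  have "\<theta> (u * inverse u) = 1" using inverse_mult_eq_1'[OF u(2)] const[of 1] by simp
  moreover have "\<theta> (u * inverse u) = (\<theta> fps_X + fps_const (- c)) * \<theta> (inverse u)"
    using u(1) inv unfolding u_def by (simp add: mult add const del: fps_const_neg)
  ultimately have "fps_nth ((\<theta> fps_X + fps_const (- c)) * \<theta> (inverse u)) 0 = fps_nth 1 0" by simp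
  then show False by (simp add: c_def)
qed

text \<open>Let d be the lowest total degree of a monomial of \<open>f\<close>; it is positive
  because f(0,0) = 0. One of the partial derivatives has a monomial of degree d - 1, whereas every
  monomial of a multiple of \<open>f\<close> has degree at least d.\<close>

lemma derivatives_not_both_multiples:
  assumes f: "f \<noteq> 0" "fps_nth (fps_nth f 0) 0 = 0"
    and X: "deriv_X f \<in> multiples f" and Y: "deriv_Y f \<in> multiples f"
  shows False
proof -
  let ?P = "\<lambda>d. \<exists>i j. i + j = d \<and> fps_nth (fps_nth f j) i \<noteq> 0"
  have "\<exists>i j. fps_nth (fps_nth f j) i \<noteq> 0" using f(1) by (auto simp: fps_eq_iff)
  then have ex: "\<exists>d. ?P d" by blast
  define d where "d = (LEAST d. ?P d)"
  have "?P d" unfolding d_def by (rule LeastI_ex[OF ex])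
  then obtain i j where ij: "i + j = d" "fps_nth (fps_nth f j) i \<noteq> 0" by blast
  have low: "fps_nth (fps_nth f j) i = 0" if "i + j < d" for i j
    using not_less_Least[of "i + j" ?P] that unfolding d_def by blast
  have low_mult: "fps_nth (fps_nth g j) i = 0" if g: "g \<in> multiples f" and lt: "i + j < d" for g i j
  proof -
    obtain a where "g = a * f" using g unfolding multiples_def by auto
    moreover have "fps_nth (fps_nth f (j - k)) (i - l) = 0" for k l
      using lt by (intro low) linarith
    ultimately show ?thesis by (simp add: fps_mult_nth fps_sum_nth)
  qed
  show False
  proof (cases i)
    case (Suc i')
    have "fps_nth (fps_nth (deriv_X f) j) i' = 0" using low_mult[OF X] Suc ij by simp
    then show False using Suc ij by (simp add: deriv_X_def del: of_nat_Suc)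
  next
    case 0
    then obtain j' where j': "j = Suc j'" using ij f(2) by (cases j) auto
    have "fps_nth (fps_nth (deriv_Y f) j') i = 0" using low_mult[OF Y] j' ij by simp
    then show False using j' ij by (simp add: deriv_Y_nth del: of_nat_Suc)
  qed
qed

section \<open>Restriction of functions to a single branch\<close>

locale branch =
  fixes f :: "complex fps fps" and \<iota> :: "complex fps fps set \<Rightarrow> complex fls"
  assumes conv: "convergent2 f" and irr: "ring_irreducible\<^bsub>CXY\<^esub> f"
    and emb: "normalization_embedding f \<iota>"
begin

text \<open>The pullback of a function along the parametrization of the branch, regarded as a
  Laurent series in t.\<close>

definition restr :: "complex fps fps \<Rightarrow> complex fls" where
  "restr g = \<iota> (local_class f g)"

lemma f_nonzero: "f \<noteq> 0"
  using irr by (simp add: ring_irreducible_def)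

lemma ideal_f: "conv_ideal (multiples f)"
  using conv by (rule conv_ideal_multiples)

lemma local_ring_eq: "local_ring f = CXY Quot multiples f"
  by (simp add: local_ring_def PIdl_CXY)

lemma local_class_eq: "local_class f g = multiples f +>\<^bsub>CXY\<^esub> g"
  by (simp add: local_class_def PIdl_CXY)

lemma local_class_carrier: "convergent2 g \<Longrightarrow> local_class f g \<in> carrier (local_ring f)"
  by (simp add: local_ring_eq local_class_eq carrier_Quot_CXY)

lemma carrier_local_ring: "carrier (local_ring f) = local_class f ` conv_ring"
  by (simp add: local_ring_eq local_class_eq carrier_Quot_CXY)

lemma hom: "\<iota> \<in> ring_hom (local_ring f) Kt" and inj: "inj_on \<iota> (carrier (local_ring f))"
  and restr_const: "restr (const2 c) = fls_const c"
  and frac: "z \<in> carrier Kt \<Longrightarrow> \<exists>a\<in>restr ` conv_ring. \<exists>b\<in>restr ` conv_ring. b \<noteq> 0 \<and> z = a / b"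
  and closure: "integral_closure (restr ` conv_ring) (carrier Kt) = Ct"
proof -
  have im: "\<iota> ` carrier (local_ring f) = restr ` conv_ring"
    by (simp add: carrier_local_ring image_image restr_def)
  show "\<iota> \<in> ring_hom (local_ring f) Kt" "inj_on \<iota> (carrier (local_ring f))"
    "restr (const2 c) = fls_const c"
    "z \<in> carrier Kt \<Longrightarrow> \<exists>a\<in>restr ` conv_ring. \<exists>b\<in>restr ` conv_ring. b \<noteq> 0 \<and> z = a / b"
    "integral_closure (restr ` conv_ring) (carrier Kt) = Ct"
    using emb unfolding normalization_embedding_def im restr_def by blast+
qed

lemma restr_add: "convergent2 g \<Longrightarrow> convergent2 h \<Longrightarrow> restr (g + h) = restr g + restr h"
  using ring_hom_add[OF hom local_class_carrier local_class_carrier, of g h]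
  by (simp add: restr_def local_ring_eq local_class_eq add_Quot_CXY[OF ideal_f] Kt_def)

lemma restr_mult: "convergent2 g \<Longrightarrow> convergent2 h \<Longrightarrow> restr (g * h) = restr g * restr h"
  using ring_hom_mult[OF hom local_class_carrier local_class_carrier, of g h]
  by (simp add: restr_def local_ring_eq local_class_eq mult_Quot_CXY[OF ideal_f] Kt_def)

lemma restr_0: "restr 0 = 0" and restr_1: "restr 1 = 1"
  using restr_const[of 0] restr_const[of 1] by simp_all

lemma restr_uminus: "convergent2 g \<Longrightarrow> restr (- g) = - restr g"
  using restr_mult[OF convergent2_const2[of "-1"], of g] restr_const[of "-1"]
  by simp

lemma restr_diff: "convergent2 g \<Longrightarrow> convergent2 h \<Longrightarrow> restr (g - h) = restr g - restr h"
  using restr_add[of g "- h"] restr_uminus[of h] by (simp add: convergent2_uminus)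

lemma restr_scale: "convergent2 g \<Longrightarrow> restr (const2 c * g) = fls_const c * restr g"
  by (simp add: restr_mult convergent2_const2 restr_const)

lemma restr_eq_iff:
  assumes "convergent2 g" "convergent2 h"
  shows "restr g = restr h \<longleftrightarrow> g - h \<in> multiples f"
  using inj_on_eq_iff[OF inj local_class_carrier[OF assms(1)] local_class_carrier[OF assms(2)]]
  by (simp add: restr_def local_class_eq coset_CXY_eq_iff[OF ideal_f])

lemma restr_eq_0_iff: "convergent2 g \<Longrightarrow> restr g = 0 \<longleftrightarrow> g \<in> multiples f"
  using restr_eq_iff[of g 0] by (simp add: restr_0 convergent2_0)

text \<open>Primality is read off from the embedding: \<open>restr\<close> is multiplicative with
  values in a field, and its kernel is \<open>multiples f\<close>.\<close>

lemma prime: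
  assumes "convergent2 a" "convergent2 b" "a * b \<in> multiples f"
  shows "a \<in> multiples f \<or> b \<in> multiples f"
  using assms restr_mult[of a b] by (simp flip: restr_eq_0_iff add: convergent2_mult)

lemma one_notin: "1 \<notin> multiples f"
  using restr_eq_0_iff[OF convergent2_1] restr_1 by simp

lemma restr_Ct:
  assumes "convergent2 g" shows "restr g \<in> Ct"
proof -
  have "restr g \<in> carrier Kt"
    using ring_hom_closed[OF hom local_class_carrier[OF assms]] by (simp add: restr_def)
  \<comment> \<open>A monic equation of degree one: an element of the branch ring is integral over
    that ring, hence lies in its integral closure C{t}.\<close>
  moreover have "restr g ^ 1 + (\<Sum>k<1. restr (- g) * restr g ^ k) = 0"
    using assms by (simp add: restr_uminus)
  ultimately have "restr g \<in> integral_closure (restr ` conv_ring) (carrier Kt)"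
    using assms unfolding integral_closure_def
    by (intro CollectI conjI exI[of _ "1::nat"] exI[of _ "\<lambda>_. restr (- g)"])
      (auto intro: convergent2_uminus)
  then show ?thesis using closure by simp
qed

text \<open>\<open>L\<close> stands for either embedding of C{t} into C{X,Y}, p(X) or p(Y). Followed
  by \<open>restr\<close> it is an endomorphism of the algebra C{t}, hence the substitution of the
  image of t.\<close>

lemma restr_compose:
  assumes lift: "\<And>p. convergent1 p \<Longrightarrow> convergent2 (L p)" "\<And>p q. L (p + q) = L p + L q"
    "\<And>p q. L (p * q) = L p * L q" "\<And>c. L (fps_const c) = const2 c"
  obtains x where "convergent1 x" "fps_nth x 0 = 0" "restr (L fps_X) = fps_to_fls x"
    "\<And>p. convergent1 p \<Longrightarrow> restr (L p) = fps_to_fls (p oo x)"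
proof -
  \<comment> \<open>Taking the regular part loses nothing here, since restrictions lie in C{t}; it
    only turns the Laurent series back into a power series.\<close>
  define \<theta> where "\<theta> p = fls_regpart (restr (L p))" for p
  have \<theta>: "restr (L p) = fps_to_fls (\<theta> p)" "convergent1 (\<theta> p)" if "convergent1 p" for p
    using restr_Ct[OF lift(1)[OF that]] unfolding Ct_iff \<theta>_def by auto
  have add: "\<theta> (p + q) = \<theta> p + \<theta> q" if "convergent1 p" "convergent1 q" for p q
    using that unfolding \<theta>_def by (simp add: lift restr_add)
  have mult: "\<theta> (p * q) = \<theta> p * \<theta> q" if "convergent1 p" "convergent1 q" for p q
  proof -
    have "fps_to_fls (\<theta> (p * q)) = fps_to_fls (\<theta> p * \<theta> q)"
      using that \<theta>[OF convergent1_mult[OF that]] \<theta>[OF that(1)] \<theta>[OF that(2)]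
      by (simp add: lift restr_mult fls_times_fps_to_fls)
    then show ?thesis by simp
  qed
  have const: "\<theta> (fps_const c) = fps_const c" for c
    unfolding \<theta>_def by (simp add: lift restr_const)
  have x0: "fps_nth (\<theta> fps_X) 0 = 0"
    by (rule alg_hom_X_nth_0) (simp_all add: add mult const)
  have comp: "\<theta> p = p oo \<theta> fps_X" if "convergent1 p" for p
    by (rule alg_hom_eq_compose) (simp_all add: add mult const x0 that)
  show ?thesis
  proof (rule that[of "\<theta> fps_X"])
    show "restr (L p) = fps_to_fls (p oo \<theta> fps_X)" if "convergent1 p" for p
      by (simp only: \<theta>(1)[OF that] comp[OF that])
  qed (simp_all add: \<theta> x0)
qed

lemma coordinates:
  obtains x y where "convergent1 x" "fps_nth x 0 = 0" "restr (fps_const fps_X) = fps_to_fls x"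
    "\<And>p. convergent1 p \<Longrightarrow> fps_to_fls (p oo x) \<in> restr ` conv_ring"
    "convergent1 y" "fps_nth y 0 = 0" "restr fps_X = fps_to_fls y"
    "\<And>p. convergent1 p \<Longrightarrow> fps_to_fls (p oo y) \<in> restr ` conv_ring"
proof -
  obtain x where x: "convergent1 x" "fps_nth x 0 = 0" "restr (fps_const fps_X) = fps_to_fls x"
    "\<And>p. convergent1 p \<Longrightarrow> restr (fps_const p) = fps_to_fls (p oo x)"
    by (rule restr_compose[of fps_const, OF convergent2_fps_const fps_const_add[symmetric]
        fps_const_mult[symmetric] const2_def[symmetric]]) (assumption, rule that)
  obtain y where y: "convergent1 y" "fps_nth y 0 = 0" "restr (lift_Y fps_X) = fps_to_fls y"
    "\<And>p. convergent1 p \<Longrightarrow> restr (lift_Y p) = fps_to_fls (p oo y)"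
    by (rule restr_compose[of lift_Y, OF convergent2_lift_Y lift_Y_add lift_Y_mult lift_Y_const])
      (assumption, rule that)
  have "fps_to_fls (p oo x) \<in> restr ` conv_ring" "fps_to_fls (p oo y) \<in> restr ` conv_ring"
    if "convergent1 p" for p
    using x(4)[OF that] y(4)[OF that] convergent2_fps_const[OF that] convergent2_lift_Y[OF that]
    by (metis image_eqI mem_Collect_eq)+
  then show ?thesis using that x(1-3) y(1-3) by (simp add: lift_Y_X)
qed

text \<open>The restriction of \<open>f\<close> to its own branch is 0; comparing constant terms in
  f = f(0,0) + X p + Y h, with x(0) = y(0) = 0, gives f(0,0) = 0.\<close>

lemma f_const_term: "fps_nth (fps_nth f 0) 0 = 0"
proof -
  obtain x y where xy: "fps_nth x 0 = 0" "restr (fps_const fps_X) = fps_to_fls x"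
    "fps_nth y 0 = 0" "restr fps_X = fps_to_fls y"
    by (rule coordinates) (rule that)
  obtain p h where ph: "convergent2 p" "convergent2 h"
    "f = const2 (fps_nth (fps_nth f 0) 0) + fps_const fps_X * p + fps_X * h"
    by (rule convergent2_split[OF conv]) (rule that, assumption+)
  have X: "convergent2 (fps_const fps_X)" "convergent2 fps_X"
    using convergent2_fps_const[of fps_X] convergent2_lift_Y[of fps_X] by (simp_all add: lift_Y_X)
  obtain p' where p': "restr p = fps_to_fls p'" using restr_Ct[OF ph(1)] Ct_iff by auto
  obtain h' where h': "restr h = fps_to_fls h'" using restr_Ct[OF ph(2)] Ct_iff by auto
  define c where "c = fps_nth (fps_nth f 0) 0"
  have "restr f = 0" using restr_eq_0_iff[OF conv] multiples_self by simp
  also have "restr f = restr (const2 c + fps_const fps_X * p + fps_X * h)"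
    using ph(3)[folded c_def] by (rule arg_cong)
  also have "\<dots> = fps_to_fls (fps_const c + x * p' + y * h')"
    using X ph(1,2)
    by (simp add: restr_add restr_mult restr_const convergent2_intros xy p' h' fls_times_fps_to_fls)
  finally have "fps_to_fls (fps_const c + x * p' + y * h') = 0" .
  then have "fps_const c + x * p' + y * h' = 0" by (simp only: fps_to_fls_eq_0_iff)
  then have "fps_nth (fps_const c + x * p' + y * h') 0 = 0" by simp
  then show ?thesis using xy by (simp add: c_def)
qed

text \<open>At least one coordinate is nonzero on the branch: otherwise every restriction would be
  constant, and t would not be a quotient of restrictions. The conductor is obtained from the
  finiteness of C{t} over that coordinate.\<close>

lemma exists_conductor:
  obtains b where "convergent2 b" "restr b \<noteq> 0" "\<And>z. z \<in> Ct \<Longrightarrow> restr b * z \<in> restr ` conv_ring"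
proof -
  obtain x y where x: "convergent1 x" "fps_nth x 0 = 0" "restr (fps_const fps_X) = fps_to_fls x"
    "\<And>p. convergent1 p \<Longrightarrow> fps_to_fls (p oo x) \<in> restr ` conv_ring"
    and y: "convergent1 y" "fps_nth y 0 = 0" "restr fps_X = fps_to_fls y"
    "\<And>p. convergent1 p \<Longrightarrow> fps_to_fls (p oo y) \<in> restr ` conv_ring"
    by (rule coordinates) (rule that)
  have "x \<noteq> 0 \<or> y \<noteq> 0"
  proof (rule ccontr)
    assume "\<not> (x \<noteq> 0 \<or> y \<noteq> 0)"
    then have 0: "restr (fps_const fps_X) = 0" "restr fps_X = 0" using x y by simp_all
    have X: "convergent2 (fps_const fps_X)" "convergent2 fps_X"
      using convergent2_fps_const[of fps_X] convergent2_lift_Y[of fps_X] by (simp_all add: lift_Y_X)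
    have const: "\<exists>c. restr g = fls_const c" if g: "convergent2 g" for g
    proof -
      obtain p h where ph: "convergent2 p" "convergent2 h"
        "g = const2 (fps_nth (fps_nth g 0) 0) + fps_const fps_X * p + fps_X * h"
        by (rule convergent2_split[OF g]) (rule that, assumption+)
      have "restr g = restr (const2 (fps_nth (fps_nth g 0) 0) + fps_const fps_X * p + fps_X * h)"
        using ph(3) by (rule arg_cong)
      then show ?thesis
        using X ph(1,2) by (auto simp: restr_add restr_mult restr_const convergent2_intros 0)
    qed
    have "fls_X \<in> carrier Kt" by (simp add: Kt_def)
    from frac[OF this] obtain a b where ab: "convergent2 a" "convergent2 b"
      "(fls_X :: complex fls) = restr a / restr b"
      by auto
    then obtain c d where "(fls_X :: complex fls) = fls_const c / fls_const d"
      using const[OF ab(1)] const[OF ab(2)] by auto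
    then have "fls_nth (fls_X :: complex fls) 1 = fls_nth (fls_const (c / d)) 1" by (simp add: fls_const_divide_const)
    then show False by simp
  qed
  then obtain s where s: "convergent1 s" "s \<noteq> 0" "fps_nth s 0 = 0"
    "\<And>p. convergent1 p \<Longrightarrow> fps_to_fls (p oo s) \<in> restr ` conv_ring"
    using x y by blast
  let ?A = "restr ` conv_ring"
  have A: "?A \<subseteq> Ct" "\<And>a b. a \<in> ?A \<Longrightarrow> b \<in> ?A \<Longrightarrow> a + b \<in> ?A" "0 \<in> ?A" "1 \<in> ?A"
    "\<And>a b. a \<in> ?A \<Longrightarrow> b \<in> ?A \<Longrightarrow> a * b \<in> ?A"
  proof -
    show "?A \<subseteq> Ct" using restr_Ct by auto
    show "0 \<in> ?A" "1 \<in> ?A"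
      using restr_0 restr_1 convergent2_0 convergent2_1 by (metis image_eqI mem_Collect_eq)+
    show "a + b \<in> ?A" "a * b \<in> ?A" if "a \<in> ?A" "b \<in> ?A" for a b
      using that by (auto simp flip: restr_add restr_mult intro!: imageI convergent2_intros)
  qed
  obtain b where "b \<in> ?A" "b \<noteq> 0" "\<And>z. z \<in> Ct \<Longrightarrow> b * z \<in> ?A"
    by (rule conductor_exists[OF A frac s]) (assumption | rule that)+
  then show ?thesis using that by auto
qed

text \<open>The bound is the order of w = g b on the branch, with b in the conductor. If h has at
  least that order, then h = g (b q) on the branch with q in C{t}, and b q is the restriction of
  some k; thus h is k g modulo \<open>f\<close>.\<close>

lemma high_order_in_ideal:
  assumes N: "conv_ideal N" "multiples f \<subseteq> N" and g: "g \<in> N" "restr g \<noteq> 0"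
  obtains m :: nat where "\<And>h. convergent2 h \<Longrightarrow> t_order (restr h) \<ge> ereal (real m) \<Longrightarrow> h \<in> N"
proof -
  obtain b where b: "convergent2 b" "restr b \<noteq> 0" "\<And>z. z \<in> Ct \<Longrightarrow> restr b * z \<in> restr ` conv_ring"
    by (rule exists_conductor) (rule that)
  have gc: "convergent2 g" using conv_idealD(1)[OF N(1) g(1)] .
  define w where "w = restr g * restr b"
  have w: "w \<in> Ct" "w \<noteq> 0" using Ct_mult restr_Ct gc b g unfolding w_def by auto
  then obtain p where p: "w = fps_to_fls p" "p \<noteq> 0" using Ct_iff by auto
  show ?thesis
  proof (rule that)
    fix h assume h: "convergent2 h" "t_order (restr h) \<ge> ereal (real (subdegree p))"
    have "t_order w = ereal (real (subdegree p))"
      using p by (simp add: t_order_def fls_subdegree_fls_to_fps)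
    then obtain q where q: "q \<in> Ct" "restr h = w * q"
      using Ct_divide[OF restr_Ct[OF h(1)] w] h(2) by metis
    obtain k where k: "convergent2 k" "restr b * q = restr k" using b(3)[OF q(1)] by auto
    have "restr h = restr g * (restr b * q)" using q(2) by (simp add: w_def mult.assoc)
    then have "restr h = restr (k * g)" using k gc by (simp add: restr_mult)
    then have "h - k * g \<in> multiples f" using restr_eq_iff h(1) k(1) gc convergent2_mult by blast
    then have "h - k * g \<in> N" using N(2) by auto
    then have "(h - k * g) + k * g \<in> N" using conv_idealD(3,4)[OF N(1)] k(1) g(1) by blast
    then show "h \<in> N" by simp
  qed
qed

lemma derivative_notin: "deriv_X f \<notin> multiples f \<or> deriv_Y f \<notin> multiples f"
  using derivatives_not_both_multiples[OF f_nonzero f_const_term] by blast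

end

section \<open>Counting orders\<close>

lemma t_order_scale: "c \<noteq> 0 \<Longrightarrow> t_order (fls_const c * z) = t_order z"
  by (simp add: t_order_def)

lemma t_order_less_iff:
  "t_order a < t_order b \<longleftrightarrow> a \<noteq> 0 \<and> (b = 0 \<or> fls_subdegree a < fls_subdegree b)"
  by (auto simp: t_order_def)

lemma t_order_add_less: "t_order a < t_order b \<Longrightarrow> t_order (a + b) = t_order a"
  unfolding t_order_less_iff
  by (cases "b = 0") (auto simp: t_order_def fls_subdegree_add_eq1,
      metis add_eq_0_iff fls_uminus_subdegree less_irrefl)

lemma t_order_add_neq:
  assumes "t_order a \<noteq> t_order b"
  shows "t_order (a + b) = t_order a \<or> t_order (a + b) = t_order b"
  using assms t_order_add_less[of a b] t_order_add_less[of b a] by (auto simp: neq_iff add.commute)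

text \<open>The quotient of the two leading coefficients is a complex number, so a scalar multiple
  of \<open>b\<close> cancels the leading term of \<open>a\<close>.\<close>

lemma t_order_cancel:
  assumes "t_order a = t_order b" "b \<noteq> 0"
  obtains c where "t_order a < t_order (a - fls_const c * b)"
proof -
  define n where "n = fls_subdegree b"
  have a: "a \<noteq> 0" "fls_subdegree a = n"
    using assms by (auto simp: t_order_def n_def split: if_splits)
  define c where "c = fls_nth a n / fls_nth b n"
  have bn: "fls_nth b n \<noteq> 0" using assms(2) by (simp add: n_def)
  have "n < fls_subdegree (a - fls_const c * b)" if "a - fls_const c * b \<noteq> 0"
  proof (rule fls_subdegree_greaterI[OF that])
    fix k assume "k \<le> n"
    show "fls_nth (a - fls_const c * b) k = 0"
    proof (cases "k = n")
      case True
      then show ?thesis using bn by (simp add: c_def)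
    next
      case False
      then have "k < fls_subdegree a" "k < fls_subdegree b" using \<open>k \<le> n\<close> a by (simp_all add: n_def)
      then show ?thesis by (simp add: fls_eq0_below_subdegree)
    qed
  qed
  then show ?thesis using a that[of c] unfolding t_order_less_iff by auto
qed

lemma t_order_Ct: "z \<in> Ct \<Longrightarrow> t_order z = \<infinity> \<or> (\<exists>n::nat. t_order z = ereal (real n))"
  by (auto simp: Ct_iff t_order_def fls_subdegree_fls_to_fps)

context branch
begin

abbreviation ord :: "complex fps fps \<Rightarrow> ereal" where
  "ord g \<equiv> t_order (restr g)"

lemma ord_nat: "convergent2 g \<Longrightarrow> ord g = \<infinity> \<or> (\<exists>n::nat. ord g = ereal (real n))"
  using t_order_Ct restr_Ct by blast

lemma ord_gap:
  assumes "convergent2 g" "ereal (real n) < ord g" shows "ereal (real (Suc n)) \<le> ord g"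
  using ord_nat[OF assms(1)] assms(2) by auto

lemma finite_ord_diff:
  assumes "P \<subseteq> conv_ring" and high: "\<And>h. h \<in> P \<Longrightarrow> ord h \<ge> ereal (real m) \<Longrightarrow> h \<in> N"
  shows "finite (ord ` P - ord ` N)"
proof (rule finite_subset)
  show "ord ` P - ord ` N \<subseteq> (\<lambda>n. ereal (real n)) ` {..<m}"
  proof
    fix d assume d: "d \<in> ord ` P - ord ` N"
    then obtain h where h: "h \<in> P" "d = ord h" by auto
    then have "\<not> d \<ge> ereal (real m)" using d high[of h] by auto
    moreover have "d = \<infinity> \<or> (\<exists>n::nat. d = ereal (real n))" using ord_nat assms(1) h by auto
    ultimately show "d \<in> (\<lambda>n. ereal (real n)) ` {..<m}" by auto
  qed
qed simp

text \<open>Induction on the number of orders of \<open>P\<close> missing in \<open>N\<close>. A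
  vector realizing a missing order is adjoined, which removes exactly that order. When none is
  missing, leading terms are cancelled by elements of \<open>N\<close> until the order reaches
  \<open>m\<close>.\<close>

lemma codim_is_card_ord:
  assumes "fps2.subspace N" "fps2.subspace P" "N \<subseteq> P" "P \<subseteq> conv_ring"
    and "\<And>h. h \<in> P \<Longrightarrow> ord h \<ge> ereal (real m) \<Longrightarrow> h \<in> N"
  shows "fps2.codim_is N (card (ord ` P - ord ` N)) P"
  using assms
proof (induction "card (ord ` P - ord ` N)" arbitrary: N)
  case 0
  note high = 0(6)
  have eq: "ord ` P \<subseteq> ord ` N"
    using 0(1) finite_ord_diff[OF 0(5), of m N] high by auto
  \<comment> \<open>The threshold descends from \<open>m\<close> as \<open>k\<close> grows; at
    \<open>k = m\<close> it is 0 and all of \<open>P\<close> is covered, including the elements of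
    order \<infinity>.\<close>
  have "h \<in> N" if "h \<in> P" "ord h \<ge> ereal (real (m - k))" for h k
    using that
  proof (induction k arbitrary: h)
    case (Suc k)
    show ?case
    proof (cases "ord h \<ge> ereal (real (m - k))")
      case False
      have hc: "convergent2 h" using Suc 0(5) by auto
      then obtain n :: nat where n: "ord h = ereal (real n)" using False ord_nat by fastforce
      then have nm: "n = m - Suc k" "Suc n = m - k" using False Suc.prems by auto
      obtain e where e: "e \<in> N" "ord h = ord e" using eq Suc.prems(1) by auto
      then have ec: "convergent2 e" using 0(4,5) by auto
      have "restr e \<noteq> 0" using e n by (auto simp: t_order_def)
      then obtain c where c: "ord h < t_order (restr h - fls_const c * restr e)"
        using t_order_cancel[OF e(2)] by blast
      have ce: "const2 c * e \<in> N" using fps2.subspace_scale[OF 0(2) e(1)] .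
      have "restr (h - const2 c * e) = restr h - fls_const c * restr e"
        using hc ec by (simp add: restr_diff restr_scale convergent2_intros)
      then have "ereal (real (Suc n)) \<le> ord (h - const2 c * e)"
        using c n hc ec by (intro ord_gap) (auto intro: convergent2_intros)
      moreover have "h - const2 c * e \<in> P"
        using fps2.subspace_diff[OF 0(3) Suc.prems(1)] ce 0(4) by auto
      ultimately have "h - const2 c * e \<in> N" using Suc.IH nm by simp
      from fps2.subspace_add[OF 0(2) this ce] show ?thesis by simp
    qed (use Suc in auto)
  qed (use high in auto)
  from this[of _ m] have "h \<in> N" if "h \<in> P" for h
    using that ord_nat[of h] 0(5) by fastforce
  then have "N = P" using 0(4) by auto
  then show ?case using fps2.codim_is_0 by simp
next
  case (Suc n)
  note high = Suc(7)
  have fin: "finite (ord ` P - ord ` N)" by (rule finite_ord_diff[OF Suc(6)]) (rule high)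
  have "ord ` P - ord ` N \<noteq> {}" using Suc(2) by force
  then obtain v where v: "v \<in> P" "ord v \<notin> ord ` N" by blast
  have vc: "convergent2 v" using v Suc(6) by auto
  define N' where "N' = fps2.adjoin v N"
  have N': "fps2.subspace N'" "N' \<subseteq> P" "N \<subseteq> N'" "v \<in> N'"
    unfolding N'_def using fps2.subspace_adjoin[OF Suc(3)] fps2.adjoin_least[OF Suc(4,5) v(1)]
      fps2.adjoin_superset fps2.adjoin_self[OF Suc(3)] by auto
  \<comment> \<open>If the coefficient of \<open>v\<close> is nonzero, the two summands of
    \<open>x\<close> have different orders, so no cancellation can produce a third order.\<close>
  have "ord x \<in> insert (ord v) (ord ` N)" if x: "x \<in> N'" for x
  proof -
    obtain k where k: "x - const2 k * v \<in> N" using x unfolding N'_def fps2.adjoin_def by auto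
    define e where "e = x - const2 k * v"
    have e: "e \<in> N" "convergent2 e" "x = e + const2 k * v" using k Suc(5,6) by (auto simp: e_def)
    show ?thesis
    proof (cases "k = 0")
      case False
      have "restr x = restr e + fls_const k * restr v"
        using e vc by (simp add: restr_add restr_scale convergent2_intros)
      moreover have eN: "ord e \<in> ord ` N" using e(1) by (rule imageI)
      then have "ord e \<noteq> ord v" using v(2) by metis
      ultimately have "ord x = ord e \<or> ord x = ord v"
        using t_order_add_neq[of "restr e" "fls_const k * restr v"] False by (simp add: t_order_scale)
      then show ?thesis using eN by auto
    qed (use e in simp)
  qed
  then have "ord ` N' = insert (ord v) (ord ` N)" using N' by auto
  then have diff: "ord ` P - ord ` N' = (ord ` P - ord ` N) - {ord v}" by auto
  have "card (ord ` P - ord ` N') = n"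
    unfolding diff using v fin Suc(2) by simp
  then have "fps2.codim_is N' n P"
    using Suc(1)[of N'] N' Suc(4,6) high by auto
  moreover have "fps2.codim_is N (Suc 0) N'"
    unfolding N'_def using v(2) by (intro fps2.codim_is_Suc fps2.codim_is_0) auto
  ultimately have "fps2.codim_is N (Suc 0 + n) P" by (rule fps2.codim_is_trans)
  then show ?case using Suc(2) by simp
qed

lemma codim_eq_ecard_ord:
  assumes N: "conv_ideal N" and P: "conv_ideal P" and "N \<subseteq> P" "multiples f \<subseteq> N" "g \<in> N" "restr g \<noteq> 0"
  shows "fps2.codim N P = ecard (ord ` P - ord ` N)"
proof -
  obtain m :: nat where m: "\<And>h. convergent2 h \<Longrightarrow> ord h \<ge> ereal (real m) \<Longrightarrow> h \<in> N"
    by (rule high_order_in_ideal[OF N assms(4-6)]) (rule that)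
  have PR: "P \<subseteq> conv_ring" using conv_idealD(1)[OF P] by auto
  have "finite (ord ` P - ord ` N)"
    by (rule finite_ord_diff[OF PR, of m]) (use PR m in auto)
  moreover have "fps2.codim_is N (card (ord ` P - ord ` N)) P"
    by (rule codim_is_card_ord[OF conv_ideal_subspace[OF N] conv_ideal_subspace[OF P] assms(3) PR])
      (use PR m in auto)
  ultimately show ?thesis
    unfolding ecard_def using fps2.codim_eqI[OF _ conv_ideal_subspace[OF N]] by simp
qed

text \<open>Multiples of \<open>f\<close> restrict to 0, so adding them does not change any
  restriction.\<close>

lemma ord_image_plus_multiples:
  assumes "conv_ideal J" shows "ord ` (J + multiples f) = ord ` J"
proof
  show "ord ` (J + multiples f) \<subseteq> ord ` J"
  proof (rule image_subsetI)
    fix x assume "x \<in> J + multiples f"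
    then obtain a b where ab: "x = a + b" "a \<in> J" "b \<in> multiples f" by (auto elim: set_plus_elim)
    then have "restr x = restr a"
      using restr_eq_0_iff[of b] conv_idealD(1)[OF assms] conv_idealD(1)[OF ideal_f]
      by (simp add: restr_add)
    then show "ord x \<in> ord ` J" using ab by simp
  qed
  show "ord ` J \<subseteq> ord ` (J + multiples f)"
    using conv_ideal_plus_superset[OF assms ideal_f] by auto
qed

end

section \<open>Tjurina ideals and the filtration of the curve\<close>

lemma linear_times: "Vector_Spaces.linear (\<lambda>c g. const2 c * g) (\<lambda>c g. const2 c * g) ((*) h)"
  unfolding Vector_Spaces.linear_iff by (intro conjI fps2.vector_space_axioms) (simp_all add: algebra_simps)

text \<open>The linear map is multiplication by 1, that is, the inclusion of \<open>V\<close> into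
  \<open>U + V\<close>.\<close>

lemma codim_second_iso:
  assumes U: "conv_ideal U" and V: "conv_ideal V"
  shows "fps2.codim (U \<inter> V) V = fps2.codim U (U + V)"
proof (rule fps2.codim_linear_bij[OF linear_times[of 1]])
  show "U + V = {u + 1 * x | u x. u \<in> U \<and> x \<in> V}" unfolding set_plus_def by auto
qed (use U V in \<open>auto intro!: conv_ideal_subspace conv_ideal_Int\<close>)

lemma conv_ideal_times:
  assumes h: "convergent2 h" and J: "conv_ideal J" shows "conv_ideal ((*) h ` J)"
proof (rule conv_idealI)
  show "convergent2 a" if "a \<in> (*) h ` J" for a
    using that h conv_idealD(1)[OF J] by (auto intro: convergent2_mult)
  show "0 \<in> (*) h ` J" using conv_idealD(2)[OF J] by force
  show "a + b \<in> (*) h ` J" if "a \<in> (*) h ` J" "b \<in> (*) h ` J" for a b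
    using that conv_idealD(3)[OF J] by (auto simp flip: distrib_left)
  show "c * a \<in> (*) h ` J" if "convergent2 c" "a \<in> (*) h ` J" for c a
    using that conv_idealD(4)[OF J] by (auto simp: mult.left_commute[of c h])
qed

lemma multiples_eq_times: "multiples g = (*) g ` conv_ring"
  unfolding multiples_def by (auto simp: mult.commute)

lemma times_multiples: "(*) h ` multiples g = multiples (h * g)"
  unfolding multiples_eq_times by (simp add: image_image mult.assoc)

lemma times_plus_absorb:
  assumes "convergent2 h" "conv_ideal J" "conv_ideal K"
  shows "(*) h ` (J + K) + K = (*) h ` J + K"
proof
  note hJ = conv_ideal_times[OF assms(1,2)]
  have "h * (j + k) \<in> (*) h ` J + K" if "j \<in> J" "k \<in> K" for j k
    using that conv_idealD(4)[OF assms(3,1)] by (auto simp: distrib_left)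
  then have "(*) h ` (J + K) \<subseteq> (*) h ` J + K" by (auto elim!: set_plus_elim)
  then show "(*) h ` (J + K) + K \<subseteq> (*) h ` J + K"
    using conv_ideal_plus_superset[OF hJ assms(3)]
    by (intro conv_ideal_plus_least conv_ideal_plus hJ assms(3))
  show "(*) h ` J + K \<subseteq> (*) h ` (J + K) + K"
    using conv_ideal_plus_superset[OF assms(2,3)] by (intro set_plus_mono2 image_mono) auto
qed

lemma deriv_X_mult: "deriv_X (g * h) = deriv_X g * h + g * deriv_X h"
  unfolding deriv_X_def
  by (intro fps_ext) (simp add: fps_mult_nth sum.distrib fps_sum_nth fps_deriv_sum)

lemma deriv_Y_mult: "deriv_Y (g * h) = deriv_Y g * h + g * deriv_Y h"
  unfolding deriv_Y_def by (simp add: add.commute)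

text \<open>Because \<open>g\<close> itself is included, this is the full preimage in C{X,Y} of the
  Jacobian ideal of the local ring of \<open>g\<close>.\<close>

definition tjurina_ideal :: "complex fps fps \<Rightarrow> complex fps fps set" where
  "tjurina_ideal g = multiples g + (multiples (deriv_X g) + multiples (deriv_Y g))"

lemma conv_ideal_tjurina: "convergent2 g \<Longrightarrow> conv_ideal (tjurina_ideal g)"
  unfolding tjurina_ideal_def by (intro conv_ideal_plus conv_ideal_multiples convergent2_intros)

lemma tjurina_ideal_subset_iff:
  assumes "convergent2 g" "conv_ideal K"
  shows "tjurina_ideal g \<subseteq> K \<longleftrightarrow> g \<in> K \<and> deriv_X g \<in> K \<and> deriv_Y g \<in> K"
proof -
  note I = conv_ideal_multiples[OF assms(1)] conv_ideal_multiples[OF convergent2_deriv_X[OF assms(1)]]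
    conv_ideal_multiples[OF convergent2_deriv_Y[OF assms(1)]]
  have "tjurina_ideal g \<subseteq> K \<longleftrightarrow>
      multiples g \<subseteq> K \<and> multiples (deriv_X g) \<subseteq> K \<and> multiples (deriv_Y g) \<subseteq> K"
    unfolding tjurina_ideal_def
    using conv_ideal_plus_superset[OF I(1) conv_ideal_plus[OF I(2,3)]]
      conv_ideal_plus_superset[OF I(2,3)] conv_ideal_plus_least[OF assms(2)]
    by (meson order_trans)
  then show ?thesis using assms(2) by (simp add: multiples_subset_iff)
qed

lemma tjurina_ideal_mem:
  assumes "convergent2 g" shows "g \<in> tjurina_ideal g" "deriv_X g \<in> tjurina_ideal g" "deriv_Y g \<in> tjurina_ideal g"
  using tjurina_ideal_subset_iff[OF assms conv_ideal_tjurina[OF assms]] by auto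

lemma tjurina_eq_codim: "convergent2 g \<Longrightarrow> tjurina g = fps2.codim (tjurina_ideal g) conv_ring"
  unfolding tjurina_def
  by (simp add: Idl3_CXY convergent2_intros quot_dim_eq_codim conv_ideal_tjurina flip: tjurina_ideal_def)

lemma inter_mult_eq_codim:
  "convergent2 g \<Longrightarrow> convergent2 h \<Longrightarrow>
    inter_mult g h = fps2.codim (multiples g + multiples h) conv_ring"
  unfolding inter_mult_def
  by (simp add: Idl2_CXY quot_dim_eq_codim conv_ideal_plus conv_ideal_multiples)

text \<open>Modulo \<open>f\<close>, the gradient of \<open>g f\<close> is \<open>g\<close> times the gradient of \<open>f\<close>.\<close>

lemma tjurina_ideal_mult:
  assumes f: "convergent2 f" and g: "convergent2 g"
  shows "tjurina_ideal (g * f) + multiples f = (*) g ` tjurina_ideal f + multiples f"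
proof
  note K = conv_ideal_multiples[OF f]
  have gf: "convergent2 (g * f)" using f g by (intro convergent2_intros)
  note T = conv_ideal_tjurina[OF gf] and T' = conv_ideal_times[OF g conv_ideal_tjurina[OF f]]
  note sup = conv_ideal_plus_superset[OF T K] and sup' = conv_ideal_plus_superset[OF T' K]
  note I = conv_ideal_plus[OF T K] and I' = conv_ideal_plus[OF T' K]
  have mem: "g * f \<in> (*) g ` tjurina_ideal f" "g * deriv_X f \<in> (*) g ` tjurina_ideal f"
    "g * deriv_Y f \<in> (*) g ` tjurina_ideal f"
    using tjurina_ideal_mem[OF f] by auto
  have fm: "h * f \<in> multiples f" if "convergent2 h" for h
    using that unfolding multiples_def by auto
  have "deriv_X (g * f) \<in> (*) g ` tjurina_ideal f + multiples f"
    unfolding deriv_X_mult using mem fm[OF convergent2_deriv_X[OF g]]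
    by (subst add.commute) (rule set_plus_intro)
  moreover have "deriv_Y (g * f) \<in> (*) g ` tjurina_ideal f + multiples f"
    unfolding deriv_Y_mult using mem fm[OF convergent2_deriv_Y[OF g]]
    by (subst add.commute) (rule set_plus_intro)
  moreover have "g * f \<in> (*) g ` tjurina_ideal f + multiples f" using mem sup' by auto
  ultimately show "tjurina_ideal (g * f) + multiples f \<subseteq> (*) g ` tjurina_ideal f + multiples f"
    using sup' by (intro conv_ideal_plus_least[OF I']) (simp_all add: tjurina_ideal_subset_iff[OF gf I'])
  let ?L = "tjurina_ideal (g * f) + multiples f"
  have L: "g * deriv_X f \<in> ?L" "g * deriv_Y f \<in> ?L" "g * f \<in> ?L"
  proof -
    have "deriv_X (g * f) - deriv_X g * f \<in> ?L"
      using tjurina_ideal_mem[OF gf] fm[OF convergent2_deriv_X[OF g]] sup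
      by (intro conv_idealD(6)[OF I]) auto
    then show "g * deriv_X f \<in> ?L" by (simp add: deriv_X_mult)
    have "deriv_Y (g * f) - deriv_Y g * f \<in> ?L"
      using tjurina_ideal_mem[OF gf] fm[OF convergent2_deriv_Y[OF g]] sup
      by (intro conv_idealD(6)[OF I]) auto
    then show "g * deriv_Y f \<in> ?L" by (simp add: deriv_Y_mult)
    show "g * f \<in> ?L" by (rule subsetD[OF sup(2) fm[OF g]])
  qed
  have "(*) g ` tjurina_ideal f \<subseteq> ?L"
  proof (rule image_subsetI)
    fix x assume "x \<in> tjurina_ideal f"
    then obtain a b c where x: "x = a * f + (b * deriv_X f + c * deriv_Y f)"
      "convergent2 a" "convergent2 b" "convergent2 c"
      unfolding tjurina_ideal_def multiples_def by (auto elim!: set_plus_elim)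
    have "g * x = a * (g * f) + (b * (g * deriv_X f) + c * (g * deriv_Y f))"
      unfolding x(1) by (simp add: algebra_simps)
    then show "g * x \<in> ?L"
      using conv_idealD(3)[OF I conv_idealD(4)[OF I x(2) L(3)]
          conv_idealD(3)[OF I conv_idealD(4)[OF I x(3) L(1)] conv_idealD(4)[OF I x(4) L(2)]]]
      by (simp only:)
  qed
  then show "(*) g ` tjurina_ideal f + multiples f \<subseteq> ?L"
    using sup by (intro conv_ideal_plus_least[OF I]) auto
qed

lemma jacobian_ideal_eq:
  assumes g: "convergent2 g"
  shows "jacobian_ideal g = local_class g ` tjurina_ideal g"
proof -
  note K = conv_ideal_multiples[OF g]
  note gX = convergent2_deriv_X[OF g] and gY = convergent2_deriv_Y[OF g]
  have carrier: "carrier (local_ring g) = local_class g ` conv_ring"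
    by (simp add: local_ring_def local_class_def carrier_Quot_CXY)
  have eq: "local_class g a \<otimes>\<^bsub>local_ring g\<^esub> local_class g (deriv_X g)
      \<oplus>\<^bsub>local_ring g\<^esub> local_class g b \<otimes>\<^bsub>local_ring g\<^esub> local_class g (deriv_Y g)
    = local_class g (a * deriv_X g + b * deriv_Y g)" if "convergent2 a" "convergent2 b" for a b
    using that gX gY K by (simp add: local_ring_def local_class_def PIdl_CXY mult_Quot_CXY add_Quot_CXY)
  have class_eq: "local_class g (c * g + h) = local_class g h" if "convergent2 c" for c h
    using that coset_CXY_eq_iff[OF K] unfolding local_class_def PIdl_CXY by (auto simp: multiples_def)
  show ?thesis
  proof (intro Set.set_eqI iffI)
    fix z assume "z \<in> jacobian_ideal g"
    then obtain A B where "A \<in> local_class g ` conv_ring" "B \<in> local_class g ` conv_ring"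
      "z = A \<otimes>\<^bsub>local_ring g\<^esub> local_class g (deriv_X g)
        \<oplus>\<^bsub>local_ring g\<^esub> B \<otimes>\<^bsub>local_ring g\<^esub> local_class g (deriv_Y g)"
      unfolding jacobian_ideal_def carrier by blast
    then obtain a b where ab: "convergent2 a" "convergent2 b"
      "z = local_class g (a * deriv_X g + b * deriv_Y g)"
      using eq by blast
    have "a * deriv_X g + b * deriv_Y g \<in> tjurina_ideal g"
      using ab conv_idealD(3,4)[OF conv_ideal_tjurina[OF g]] tjurina_ideal_mem[OF g] by simp
    then show "z \<in> local_class g ` tjurina_ideal g" using ab by simp
  next
    fix z assume "z \<in> local_class g ` tjurina_ideal g"
    then obtain a b c where z: "z = local_class g (c * g + (a * deriv_X g + b * deriv_Y g))"
      "convergent2 a" "convergent2 b" "convergent2 c"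
      unfolding tjurina_ideal_def multiples_def by (auto elim!: set_plus_elim)
    then show "z \<in> jacobian_ideal g"
      unfolding jacobian_ideal_def carrier z(1) class_eq[OF z(4)] eq[OF z(2,3), symmetric]
      using z(2,3) by blast
  qed
qed

context branch
begin

text \<open>Multiplication by \<open>h\<close> induces an isomorphism of the two quotients.
  Injectivity is cancellation modulo the prime \<open>f\<close>: if h x = h j + k with k in (f),
  then x - j lies in (f), which is contained in \<open>J\<close>.\<close>

lemma codim_times:
  assumes h: "convergent2 h" "h \<notin> multiples f" and J: "conv_ideal J" "multiples f \<subseteq> J"
  shows "fps2.codim ((*) h ` J + multiples f) (multiples h + multiples f) = fps2.codim J conv_ring"
proof (rule fps2.codim_linear_bij[OF linear_times[of h], symmetric])
  note U' = conv_ideal_plus[OF conv_ideal_times[OF h(1) J(1)] ideal_f]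
  show "fps2.subspace J" "fps2.subspace conv_ring" "fps2.subspace ((*) h ` J + multiples f)"
    "J \<subseteq> conv_ring"
    using J U' conv_ideal_ring conv_idealD(1)[OF J(1)] by (auto intro: conv_ideal_subspace)
  show "h * x \<in> (*) h ` J + multiples f \<longleftrightarrow> x \<in> J" if "x \<in> conv_ring" for x
  proof
    assume "h * x \<in> (*) h ` J + multiples f"
    then obtain j k where jk: "h * x = h * j + k" "j \<in> J" "k \<in> multiples f" by (blast elim: set_plus_elim)
    then have "h * (x - j) \<in> multiples f" by (simp add: right_diff_distrib)
    then have "x - j \<in> multiples f"
      using prime[of h "x - j"] h that conv_idealD(1)[OF J(1) jk(2)] by (auto intro: convergent2_diff)
    then show "x \<in> J" using conv_idealD(3)[OF J(1), of "x - j" j] J(2) jk by auto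
  next
    assume "x \<in> J"
    then show "h * x \<in> (*) h ` J + multiples f"
      using conv_ideal_plus_superset[OF conv_ideal_times[OF h(1) J(1)] ideal_f] by auto
  qed
  show "multiples h + multiples f = {u + h * x | u x. u \<in> (*) h ` J + multiples f \<and> x \<in> conv_ring}"
  proof (intro Set.set_eqI iffI)
    fix y assume "y \<in> multiples h + multiples f"
    then have "y \<in> multiples f + (*) h ` conv_ring" by (simp only: multiples_eq_times[of h] add.commute)
    then obtain a k where y: "y = k + h * a" "convergent2 a" "k \<in> multiples f"
      by (blast elim: set_plus_elim)
    then have "k \<in> (*) h ` J + multiples f"
      using conv_ideal_plus_superset[OF conv_ideal_times[OF h(1) J(1)] ideal_f] by auto
    then show "y \<in> {u + h * x | u x. u \<in> (*) h ` J + multiples f \<and> x \<in> conv_ring}" using y by auto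
  next
    fix y assume "y \<in> {u + h * x | u x. u \<in> (*) h ` J + multiples f \<and> x \<in> conv_ring}"
    then obtain j k x where y: "y = (h * j + k) + h * x" "j \<in> J" "k \<in> multiples f" "convergent2 x"
      by (blast elim: set_plus_elim)
    then have eq: "y = h * (j + x) + k" by (simp add: algebra_simps)
    have "h * (j + x) \<in> multiples h"
      using y conv_idealD(1)[OF J(1)] unfolding multiples_eq_times by (auto intro: convergent2_add)
    then show "y \<in> multiples h + multiples f" unfolding eq using y(3) by (rule set_plus_intro)
  qed
qed

lemma prod_notin:
  assumes "\<And>j. j \<in> L \<Longrightarrow> convergent2 (g j)" "\<And>j. j \<in> L \<Longrightarrow> g j \<notin> multiples f"
  shows "prod g L \<notin> multiples f"
  using assms
proof (induction L rule: infinite_finite_induct)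
  case (insert j L)
  then have "convergent2 (prod g L)" by (intro convergent2_prod) auto
  then have "g j * prod g L \<notin> multiples f" using prime[of "g j" "prod g L"] insert by blast
  then show ?case using insert(1,2) by simp
qed (use one_notin in simp_all)

text \<open>Additivity of the intersection number in one argument, from the inclusions of (g_j q, f)
  in (g_j, f) and of (g_j, f) in the whole ring. The lower step is the whole ring modulo (q, f),
  multiplied by g_j.\<close>

lemma codim_multiples_prod:
  assumes "finite L" "\<And>j. j \<in> L \<Longrightarrow> convergent2 (g j)" "\<And>j. j \<in> L \<Longrightarrow> g j \<notin> multiples f"
  shows "fps2.codim (multiples (prod g L) + multiples f) conv_ring
    = (\<Sum>j\<in>L. fps2.codim (multiples (g j) + multiples f) conv_ring)"
  using assms
proof (induction L)
  case empty
  have "multiples 1 + multiples f = conv_ring"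
    using conv_ideal_plus_absorb[OF ideal_f conv_ideal_ring] conv_idealD(1)[OF ideal_f]
    by (auto simp: multiples_eq_times add.commute)
  then show ?case using fps2.codim_self[OF conv_ideal_subspace[OF conv_ideal_ring]] by simp
next
  case (insert j L)
  define q where "q = prod g L"
  have q: "convergent2 q" unfolding q_def using insert by (intro convergent2_prod) auto
  have j: "convergent2 (g j)" "g j \<notin> multiples f" using insert by auto
  note J = conv_ideal_plus[OF conv_ideal_multiples[OF q] ideal_f]
  have eq: "(*) (g j) ` (multiples q + multiples f) + multiples f = multiples (g j * q) + multiples f"
    using times_plus_absorb[OF j(1) conv_ideal_multiples[OF q] ideal_f] by (simp add: times_multiples)
  have "g j * q \<in> multiples (g j)"
    using conv_idealD(4)[OF conv_ideal_multiples[OF j(1)] q multiples_self] by (simp add: mult.commute)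
  then have sub: "multiples (g j * q) + multiples f \<subseteq> multiples (g j) + multiples f"
    using conv_ideal_multiples[OF j(1)] by (intro set_plus_mono2) (simp_all add: multiples_subset_iff)
  note I = conv_ideal_plus[OF conv_ideal_multiples[OF convergent2_mult[OF j(1) q]] ideal_f]
    and I' = conv_ideal_plus[OF conv_ideal_multiples[OF j(1)] ideal_f]
  have "fps2.codim (multiples (g j * q) + multiples f) conv_ring
    = fps2.codim (multiples (g j * q) + multiples f) (multiples (g j) + multiples f)
      + fps2.codim (multiples (g j) + multiples f) conv_ring"
    using conv_idealD(1)[OF I']
    by (intro fps2.codim_add conv_ideal_subspace I I' sub) auto
  also have "fps2.codim (multiples (g j * q) + multiples f) (multiples (g j) + multiples f)
    = fps2.codim (multiples q + multiples f) conv_ring"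
    using codim_times[OF j J] conv_ideal_plus_superset[OF conv_ideal_multiples[OF q] ideal_f] eq by simp
  finally show ?case using insert by (simp add: q_def add.commute)
qed

end

section \<open>The filtration of the whole curve\<close>

locale curve =
  fixes r :: nat and f :: "nat \<Rightarrow> complex fps fps" and \<iota> :: "nat \<Rightarrow> complex fps fps set \<Rightarrow> complex fls"
  assumes conv: "i \<in> {1..r} \<Longrightarrow> convergent2 (f i)"
    and irr: "i \<in> {1..r} \<Longrightarrow> ring_irreducible\<^bsub>CXY\<^esub> (f i)"
    and distinct: "i \<in> {1..r} \<Longrightarrow> j \<in> {1..r} \<Longrightarrow> i \<noteq> j \<Longrightarrow> multiples (f i) \<noteq> multiples (f j)"
    and emb: "i \<in> {1..r} \<Longrightarrow> normalization_embedding (f i) (\<iota> i)"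
begin

definition F :: "complex fps fps" where
  "F = (\<Prod>i\<in>{1..r}. f i)"

text \<open>The product h_i of the overview, with \<open>high\<close> as its k_i. The value at 1 is
  the empty product and the value at \<open>Suc r\<close> is \<open>F\<close>, so the filtration
  runs from the whole ring down to \<open>jac\<close>.\<close>

definition low :: "nat \<Rightarrow> complex fps fps" where
  "low i = (\<Prod>l\<in>{1..<i}. f l)"

definition high :: "nat \<Rightarrow> complex fps fps" where
  "high i = (\<Prod>l\<in>{i<..r}. f l)"

lemma branch: "i \<in> {1..r} \<Longrightarrow> branch (f i) (\<iota> i)"
  using conv irr emb by (simp add: branch_def)

lemma convergent2_F: "convergent2 F" and convergent2_high: "convergent2 (high i)"
  unfolding F_def high_def using conv by (auto intro!: convergent2_prod)

lemma convergent2_low: "i \<le> Suc r \<Longrightarrow> convergent2 (low i)"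
  unfolding low_def using conv by (intro convergent2_prod) auto

lemma low_1: "low (Suc 0) = 1"
  by (simp add: low_def)

lemma low_Suc: "i \<ge> 1 \<Longrightarrow> low (Suc i) = f i * low i"
proof -
  assume "i \<ge> 1"
  then have "{1..<Suc i} = insert i {1..<i}" by auto
  then show ?thesis unfolding low_def by simp
qed

lemma F_split:
  assumes "i \<in> {1..r}" shows "F = low i * high i * f i"
proof -
  have "{1..r} = insert i ({1..<i} \<union> {i<..r})" using assms by auto
  moreover have "prod f ({1..<i} \<union> {i<..r}) = low i * high i" 
    unfolding low_def high_def by (intro prod.union_disjoint) auto
  ultimately show ?thesis unfolding F_def by (simp add: mult_ac)
qed

text \<open>If f_i divided f_j, it would not be a proper factor, because f_j is irreducible and f_i
  is not a unit. The two would then be associated and generate the same ideal.\<close>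

lemma notin:
  assumes i: "i \<in> {1..r}" and j: "j \<in> {1..r}" and ij: "i \<noteq> j"
  shows "f j \<notin> multiples (f i)"
proof
  assume "f j \<in> multiples (f i)"
  then obtain a where a: "convergent2 a" "f j = a * f i" unfolding multiples_def by auto
  have "f i \<notin> Units CXY" using irr[OF i] by (simp add: ring_irreducible_def irreducible_def)
  then have "\<not> properfactor CXY (f i) (f j)"
    using irr[OF j] conv[OF i] by (auto simp: ring_irreducible_def irreducible_def)
  moreover have "f i divides\<^bsub>CXY\<^esub> f j" using a by (auto simp: factor_def mult.commute)
  ultimately have "f j divides\<^bsub>CXY\<^esub> f i" by (simp add: properfactor_def)
  then obtain b where "convergent2 b" "f i = f j * b" by (auto simp: factor_def)
  then have "f i \<in> multiples (f j)" unfolding multiples_def by (auto simp: mult.commute)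
  then have "multiples (f i) = multiples (f j)"
    using \<open>f j \<in> multiples (f i)\<close> conv_ideal_multiples[OF conv[OF i]] conv_ideal_multiples[OF conv[OF j]]
    by (auto simp flip: multiples_subset_iff)
  then show False using distinct[OF i j ij] by simp
qed

lemma low_notin: "low i \<notin> multiples (f i)" and high_notin: "high i \<notin> multiples (f i)"
  if "i \<in> {1..r}" for i
  unfolding low_def high_def using that
  by (intro branch.prod_notin[OF branch[OF that]] conv notin; simp)+

text \<open>A common multiple a h_i of h_i and f_i has a divisible by f_i, because f_i is prime and
  does not divide h_i.\<close>

lemma multiples_low_Suc:
  assumes i: "i \<in> {1..r}"
  shows "multiples (low (Suc i)) = multiples (low i) \<inter> multiples (f i)"
proof -
  have li: "convergent2 (low i)" using i by (intro convergent2_low) auto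
  have low: "low (Suc i) = f i * low i" using i by (intro low_Suc) simp
  show ?thesis
  proof (intro Set.set_eqI iffI)
    fix g assume "g \<in> multiples (low (Suc i))"
    then obtain a where a: "convergent2 a" "g = a * (f i * low i)" unfolding multiples_def low by auto
    have "g = (a * f i) * low i" "g = (a * low i) * f i" using a by (simp_all add: mult_ac)
    then show "g \<in> multiples (low i) \<inter> multiples (f i)"
      unfolding multiples_def using a(1) li conv[OF i] convergent2_mult by blast
  next
    fix g assume g: "g \<in> multiples (low i) \<inter> multiples (f i)"
    then obtain a where a: "convergent2 a" "g = a * low i" unfolding multiples_def by auto
    then have "a \<in> multiples (f i)" using branch.prime[OF branch[OF i] a(1) li] g low_notin[OF i] by auto
    then obtain b where b: "convergent2 b" "a = b * f i" unfolding multiples_def by auto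
    then have "g = b * low (Suc i)" using a low by (simp add: mult_ac)
    then show "g \<in> multiples (low (Suc i))" unfolding multiples_def using b(1) by blast
  qed
qed

lemma mem_multiples_low_iff:
  "n \<le> r \<Longrightarrow> g \<in> multiples (low (Suc n)) \<longleftrightarrow> convergent2 g \<and> (\<forall>l\<in>{1..<Suc n}. g \<in> multiples (f l))"
proof (induction n)
  case 0
  then show ?case by (simp add: multiples_eq_times low_1)
next
  case (Suc n)
  have "g \<in> multiples (low (Suc (Suc n))) \<longleftrightarrow> g \<in> multiples (low (Suc n)) \<and> g \<in> multiples (f (Suc n))"
    using multiples_low_Suc[of "Suc n"] Suc.prems by simp
  moreover have "{1..<Suc (Suc n)} = insert (Suc n) {1..<Suc n}" by auto
  ultimately show ?case using Suc by auto
qed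

abbreviation jac :: "complex fps fps set" where
  "jac \<equiv> tjurina_ideal F"

lemma graded_piece:
  assumes i: "i \<in> {1..r}"
  shows "fps2.codim (jac + multiples (low (Suc i))) (jac + multiples (low i)) =
    tjurina (f i) + (\<Sum>j\<in>{i<..r}. inter_mult (f i) (f j)) +
    ecard (branch.ord (f i) (\<iota> i) ` jac - branch.ord (f i) (\<iota> i) ` (jac \<inter> multiples (low i)))"
proof -
  note curve_conv = conv
  interpret branch "f i" "\<iota> i" by (rule branch[OF i])
  have li: "convergent2 (low i)" using i by (intro convergent2_low) auto
  define K where "K = multiples (f i)"
  define M where "M = multiples (low i)"
  define M' where "M' = multiples (low (Suc i))"
  define N where "N = jac \<inter> M"
  have K: "conv_ideal K" and M: "conv_ideal M" and P: "conv_ideal jac"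
    unfolding K_def M_def
    by (rule ideal_f, rule conv_ideal_multiples[OF li], rule conv_ideal_tjurina[OF convergent2_F])
  have M'_eq: "M' = M \<inter> K" unfolding M'_def M_def K_def by (rule multiples_low_Suc[OF i])
  have M': "conv_ideal M'" unfolding M'_eq by (rule conv_ideal_Int[OF M K])
  have N: "conv_ideal N" unfolding N_def by (rule conv_ideal_Int[OF P M])
  note PM' = conv_ideal_plus[OF P M'] and PM = conv_ideal_plus[OF P M]
  note NK = conv_ideal_plus[OF N K] and PK = conv_ideal_plus[OF P K] and MK = conv_ideal_plus[OF M K]
  have NP: "N + K \<subseteq> jac + K" unfolding N_def by (intro set_plus_mono2) auto
  \<comment> \<open>The modular law: since \<open>M'\<close> and \<open>N\<close> are contained in
    \<open>M\<close>, both sides equal \<open>N + M'\<close>, where \<open>M'\<close> is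
    \<open>M \<inter> K\<close>.\<close>
  have modular: "(jac + M') \<inter> M = (N + K) \<inter> M"
  proof (intro Set.set_eqI iffI)
    fix x assume x: "x \<in> (jac + M') \<inter> M"
    then obtain p m where pm: "x = p + m" "p \<in> jac" "m \<in> M'" by (blast elim: set_plus_elim)
    then have "x - m \<in> M" using x conv_idealD(6)[OF M] M'_eq by blast
    then have "p \<in> N" using pm by (simp add: N_def)
    then show "x \<in> (N + K) \<inter> M" using pm M'_eq x by (blast intro: set_plus_intro)
  next
    fix x assume x: "x \<in> (N + K) \<inter> M"
    then obtain p m where pm: "x = p + m" "p \<in> N" "m \<in> K" by (blast elim: set_plus_elim)
    then have "x - p \<in> M" using x conv_idealD(6)[OF M] N_def by blast
    then have "m \<in> M'" using pm by (simp add: M'_eq)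
    then show "x \<in> (jac + M') \<inter> M" using pm N_def x by (blast intro: set_plus_intro)
  qed
  have "fps2.codim (jac + M') (jac + M) = fps2.codim ((jac + M') \<inter> M) M"
    using conv_ideal_plus_absorb[OF M' M] M'_eq codim_second_iso[OF PM' M] by (simp add: add.assoc)
  \<comment> \<open>A second use of the isomorphism theorem, now for \<open>N + K\<close> and
    \<open>M\<close>; the modular identity makes the two intersections agree.\<close>
  also have "\<dots> = fps2.codim (N + K) (M + K)"
  proof -
    have "N + K + M = (N + M) + K" by (simp only: add.assoc add.commute[of K M])
    also have "N + M = M" using conv_ideal_plus_absorb[OF N M] by (simp add: N_def)
    finally show ?thesis using codim_second_iso[OF NK M] modular by simp
  qed
  also have "\<dots> = fps2.codim (N + K) (jac + K) + fps2.codim (jac + K) (M + K)"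
  proof (intro fps2.codim_add conv_ideal_subspace NK PK NP)
    have "jac + K = (*) (low i * high i) ` tjurina_ideal (f i) + K"
      unfolding F_split[OF i] K_def
      by (intro tjurina_ideal_mult conv convergent2_mult li convergent2_high i)
    also have "\<dots> \<subseteq> M + K"
    proof (intro set_plus_mono2 image_subsetI)
      fix x assume "x \<in> tjurina_ideal (f i)"
      then have "convergent2 (high i * x)"
        using conv_idealD(1)[OF conv_ideal_tjurina[OF curve_conv[OF i]]] convergent2_high by (blast intro: convergent2_mult)
      then show "low i * high i * x \<in> M" unfolding M_def multiples_eq_times by (auto simp: mult.assoc)
    qed simp
    finally show "jac + K \<subseteq> M + K" .
  qed
  also have "fps2.codim (N + K) (jac + K) = ecard (ord ` jac - ord ` N)"
  proof -
    \<comment> \<open>A partial derivative of f_i that is nonzero on the branch. Modulo f_i, its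
      product with h_i k_i agrees with an element \<open>p\<close> of \<open>jac\<close>.\<close>
    obtain d where d: "d \<in> {deriv_X (f i), deriv_Y (f i)}" "d \<notin> K"
      "low i * high i * d \<in> jac + K"
    proof -
      have *: "low i * high i * d \<in> jac + K" if "d \<in> tjurina_ideal (f i)" for d
      proof -
        have "(*) (low i * high i) ` tjurina_ideal (f i) + K = jac + K"
          unfolding F_split[OF i] K_def
          by (intro tjurina_ideal_mult[symmetric] conv convergent2_mult li convergent2_high i)
        moreover have "low i * high i * d \<in> (*) (low i * high i) ` tjurina_ideal (f i) + K"
          using that conv_ideal_plus_superset(1)[OF conv_ideal_times[OF convergent2_mult[OF li convergent2_high]
                conv_ideal_tjurina[OF curve_conv[OF i]]] K] by blast
        ultimately show ?thesis by simp
      qed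
      show ?thesis
        using derivative_notin *[OF tjurina_ideal_mem(2)[OF curve_conv[OF i]]]
          *[OF tjurina_ideal_mem(3)[OF curve_conv[OF i]]] that unfolding K_def by blast
    qed
    have dc: "convergent2 d" using d(1) curve_conv[OF i] by (auto intro: convergent2_intros)
    obtain p k where pk: "low i * high i * d = p + k" "p \<in> jac" "k \<in> K"
      using d(3) by (blast elim: set_plus_elim)
    have pc: "convergent2 p" and kc: "convergent2 k" using pk conv_idealD(1)[OF P] conv_idealD(1)[OF K] by auto
    \<comment> \<open>The extra factor h_i moves \<open>p\<close> into \<open>M\<close>, and it does
      not vanish on the branch. This is the witness required for counting orders.\<close>
    have "low i * p \<in> N"
      using conv_idealD(4)[OF P li pk(2)] pc unfolding N_def M_def multiples_eq_times by auto
    moreover have "restr (low i * p) \<noteq> 0"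
    proof -
      have "restr p = restr (low i * high i * d)"
        using pk kc pc restr_eq_0_iff[OF kc] by (simp add: restr_add K_def)
      also have "\<dots> \<noteq> 0"
        using li convergent2_high[of i] dc low_notin[OF i] high_notin[OF i] d(2)
        by (simp add: restr_mult convergent2_mult restr_eq_0_iff K_def)
      finally show ?thesis using li pc low_notin[OF i] by (simp add: restr_mult restr_eq_0_iff)
    qed
    ultimately have "fps2.codim (N + K) (jac + K) = ecard (ord ` (jac + K) - ord ` (N + K))"
      using conv_ideal_plus_superset[OF N K]
      by (intro codim_eq_ecard_ord[OF NK PK NP, of "low i * p"]) (auto simp flip: K_def)
    then show ?thesis using ord_image_plus_multiples[OF P] ord_image_plus_multiples[OF N] by (simp add: K_def)
  qed
  also have "fps2.codim (jac + K) (M + K) = tjurina (f i) + (\<Sum>j\<in>{i<..r}. inter_mult (f i) (f j))"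
  proof -
    note T = conv_ideal_tjurina[OF curve_conv[OF i]]
    note hT = conv_ideal_times[OF convergent2_high[of i] T]
    have KT: "K \<subseteq> tjurina_ideal (f i)"
      unfolding K_def using tjurina_ideal_mem[OF curve_conv[OF i]] by (simp add: multiples_subset_iff[OF T])
    have J: "conv_ideal ((*) (high i) ` tjurina_ideal (f i) + K)" by (rule conv_ideal_plus[OF hT K])
    \<comment> \<open>The factors h_i and k_i are separated: cancelling h_i gives a codimension in
      the whole ring, which is then split at the ideal generated by k_i and f_i.\<close>
    have "jac + K = (*) (low i * high i) ` tjurina_ideal (f i) + K"
      unfolding F_split[OF i] K_def
      by (intro tjurina_ideal_mult conv convergent2_mult li convergent2_high i)
    also have "\<dots> = (*) (low i) ` ((*) (high i) ` tjurina_ideal (f i) + K) + K"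
      unfolding times_plus_absorb[OF li hT K] by (simp add: image_image mult.assoc)
    finally have "fps2.codim (jac + K) (M + K)
        = fps2.codim ((*) (high i) ` tjurina_ideal (f i) + K) conv_ring"
      using codim_times[OF li low_notin[OF i] J] conv_ideal_plus_superset(2)[OF hT K]
      by (simp add: K_def M_def)
    also have "\<dots> = fps2.codim ((*) (high i) ` tjurina_ideal (f i) + K) (multiples (high i) + K)
        + fps2.codim (multiples (high i) + K) conv_ring"
    proof (intro fps2.codim_add conv_ideal_subspace J conv_ideal_plus conv_ideal_multiples convergent2_high K)
      show "(*) (high i) ` tjurina_ideal (f i) + K \<subseteq> multiples (high i) + K"
        unfolding multiples_eq_times using conv_idealD(1)[OF T] by (intro set_plus_mono2 image_mono) auto
      show "multiples (high i) + K \<subseteq> conv_ring"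
        using conv_idealD(1)[OF conv_ideal_plus[OF conv_ideal_multiples[OF convergent2_high] K]] by blast
    qed
    also have "fps2.codim ((*) (high i) ` tjurina_ideal (f i) + K) (multiples (high i) + K) = tjurina (f i)"
      using codim_times[OF convergent2_high high_notin[OF i] T] KT tjurina_eq_codim[OF curve_conv[OF i]]
      by (simp add: K_def)
    also have "fps2.codim (multiples (high i) + K) conv_ring = (\<Sum>j\<in>{i<..r}. inter_mult (f i) (f j))"
    proof -
      have "fps2.codim (multiples (high i) + K) conv_ring
          = (\<Sum>j\<in>{i<..r}. fps2.codim (multiples (f j) + K) conv_ring)"
        unfolding K_def high_def using i curve_conv notin[OF i] by (intro codim_multiples_prod) auto
      also have "\<dots> = (\<Sum>j\<in>{i<..r}. inter_mult (f i) (f j))"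
        using i curve_conv by (intro sum.cong) (auto simp: K_def inter_mult_eq_codim add.commute)
      finally show ?thesis .
    qed
    finally show ?thesis .
  qed
  finally show ?thesis unfolding N_def M_def M'_def by (simp add: add_ac)
qed

lemma codim_filtration:
  "n \<le> r \<Longrightarrow> fps2.codim (jac + multiples (low (Suc n))) conv_ring =
    (\<Sum>i\<in>{1..n}. fps2.codim (jac + multiples (low (Suc i))) (jac + multiples (low i)))"
proof (induction n)
  case 0
  have "jac + multiples 1 = conv_ring"
    using conv_ideal_plus_absorb[OF conv_ideal_tjurina[OF convergent2_F] conv_ideal_ring]
      conv_idealD(1)[OF conv_ideal_tjurina[OF convergent2_F]]
    by (auto simp: multiples_eq_times)
  then have "jac + multiples (low (Suc 0)) = conv_ring" by (simp only: low_1)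
  then show ?case using fps2.codim_self[OF conv_ideal_subspace[OF conv_ideal_ring]] by simp
next
  case (Suc n)
  have I: "conv_ideal (jac + multiples (low (Suc m)))" if "m \<le> r" for m
    using that by (intro conv_ideal_plus conv_ideal_tjurina conv_ideal_multiples convergent2_F convergent2_low) auto
  have "multiples (low (Suc (Suc n))) \<subseteq> multiples (low (Suc n))"
    using multiples_low_Suc[of "Suc n"] Suc.prems by auto
  then have "fps2.codim (jac + multiples (low (Suc (Suc n)))) conv_ring =
      fps2.codim (jac + multiples (low (Suc (Suc n)))) (jac + multiples (low (Suc n)))
      + fps2.codim (jac + multiples (low (Suc n))) conv_ring"
    using conv_idealD(1)[OF I[of n]] I[OF Suc.prems] I[of n] Suc.prems
    by (intro fps2.codim_add conv_ideal_subspace set_plus_mono2) auto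
  then show ?case using Suc by (simp add: add.commute)
qed

lemma tjurina_F:
  assumes "r \<ge> 1"
  shows "tjurina F = (\<Sum>i\<in>{1..r}. tjurina (f i))
    + (\<Sum>(i, j) \<in> {(i, j). 1 \<le> i \<and> i < j \<and> j \<le> r}. inter_mult (f i) (f j))
    + (\<Sum>i\<in>{2..r}. ecard (branch.ord (f i) (\<iota> i) ` jac
        - branch.ord (f i) (\<iota> i) ` (jac \<inter> multiples (low i))))"
    (is "_ = ?T + ?I + (\<Sum>i\<in>_. ?E i)")
proof -
  have "low (Suc r) = F" by (simp add: low_def F_def atLeastLessThanSuc_atLeastAtMost)
  moreover have "multiples F \<subseteq> jac"
    using tjurina_ideal_mem[OF convergent2_F]
    by (simp add: multiples_subset_iff[OF conv_ideal_tjurina[OF convergent2_F]])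
  \<comment> \<open>The last member of the filtration is \<open>jac\<close> itself, because
    \<open>F\<close> lies in its own Tjurina ideal.\<close>
  ultimately have "jac + multiples (low (Suc r)) = jac"
    using conv_ideal_plus_absorb[OF conv_ideal_multiples[OF convergent2_F] conv_ideal_tjurina[OF convergent2_F]]
    by (simp add: add.commute)
  then have "tjurina F = (\<Sum>i\<in>{1..r}. fps2.codim (jac + multiples (low (Suc i))) (jac + multiples (low i)))"
    using codim_filtration[of r] tjurina_eq_codim[OF convergent2_F] by simp
  also have "\<dots> = (\<Sum>i\<in>{1..r}. tjurina (f i) + (\<Sum>j\<in>{i<..r}. inter_mult (f i) (f j)) + ?E i)"
    by (intro sum.cong refl graded_piece)
  also have "\<dots> = ?T + (\<Sum>i\<in>{1..r}. \<Sum>j\<in>{i<..r}. inter_mult (f i) (f j)) + (\<Sum>i\<in>{1..r}. ?E i)"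
    by (simp only: sum.distrib)
  also have "(\<Sum>i\<in>{1..r}. \<Sum>j\<in>{i<..r}. inter_mult (f i) (f j)) = ?I"
  proof -
    have "{(i, j). 1 \<le> i \<and> i < j \<and> j \<le> r} = (SIGMA i:{1..r}. {i<..r})" by auto
    then show ?thesis by (simp add: sum.Sigma)
  qed
  also have "(\<Sum>i\<in>{1..r}. ?E i) = (\<Sum>i\<in>{2..r}. ?E i)"
  proof -
    \<comment> \<open>For the first branch there is no vanishing condition, so the difference of
      order sets is empty.\<close>
    have "jac \<inter> multiples (low 1) = jac"
      using conv_idealD(1)[OF conv_ideal_tjurina[OF convergent2_F]] by (auto simp: multiples_eq_times low_1)
    then have "?E 1 = 0" by (simp add: ecard_def zero_enat_def)
    moreover have "{1..r} = insert 1 {2..r}" using assms by auto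
    ultimately show ?thesis by simp
  qed
  finally show ?thesis .
qed

section \<open>Return to the total ring of fractions\<close>

lemma incl_K_class:
  assumes "convergent2 g" "i \<in> {1..r}"
  shows "incl_K {1..r} f \<iota> (local_class F g) i = branch.restr (f i) (\<iota> i) g"
proof -
  note K = conv_ideal_multiples[OF conv[OF assms(2)]]
  have "convergent2 (low i * high i)"
    using assms(2) by (intro convergent2_mult convergent2_low convergent2_high) auto
  then have sub: "multiples F \<subseteq> multiples (f i)"
    unfolding multiples_subset_iff[OF K] F_split[OF assms(2)] unfolding multiples_def by blast
  \<comment> \<open>Adding (f_i) to a coset of (F) gives a coset of (f_i), because (F) is contained
    in (f_i).\<close>
  have "local_class F g <+>\<^bsub>CXY\<^esub> PIdl\<^bsub>CXY\<^esub> (f i) = local_class (f i) g"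
  proof -
    have "x \<in> {a + b | a b. a - g \<in> multiples F \<and> b \<in> multiples (f i)} \<longleftrightarrow> x - g \<in> multiples (f i)" for x
    proof
      assume "x \<in> {a + b | a b. a - g \<in> multiples F \<and> b \<in> multiples (f i)}"
      then obtain a b where ab: "x = a + b" "a - g \<in> multiples (f i)" "b \<in> multiples (f i)"
        using sub by blast
      from conv_idealD(3)[OF K ab(2,3)] ab(1) show "x - g \<in> multiples (f i)" by (simp add: algebra_simps)
    next
      assume "x - g \<in> multiples (f i)"
      then show "x \<in> {a + b | a b. a - g \<in> multiples F \<and> b \<in> multiples (f i)}"
        using conv_idealD(2)[OF conv_ideal_multiples[OF convergent2_F]]
        by (intro CollectI exI[of _ g] exI[of _ "x - g"]) simp
    qed
    then have "{a + b | a b. a - g \<in> multiples F \<and> b \<in> multiples (f i)} = {x. x - g \<in> multiples (f i)}"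
      by blast
    moreover have "local_class F g <+>\<^bsub>CXY\<^esub> PIdl\<^bsub>CXY\<^esub> (f i)
        = {a + b | a b. a - g \<in> multiples F \<and> b \<in> multiples (f i)}"
      unfolding local_class_def PIdl_CXY coset_CXY set_add_def' by auto
    ultimately show ?thesis by (simp add: local_class_def PIdl_CXY coset_CXY)
  qed
  then show ?thesis
    using assms(2) by (simp add: incl_K_def branch.restr_def[OF branch])
qed

lemma t_order_jacobian_K:
  assumes "i \<in> {1..r}"
  shows "t_order ` (proj i ` jacobian_K {1..r} f \<iota>) = branch.ord (f i) (\<iota> i) ` jac"
proof -
  have "t_order (proj i (incl_K {1..r} f \<iota> (local_class F g))) = branch.ord (f i) (\<iota> i) g" if "g \<in> jac" for g
    using that incl_K_class[OF _ assms] conv_idealD(1)[OF conv_ideal_tjurina[OF convergent2_F]]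
    by (simp add: proj_def)
  then show ?thesis
    unfolding jacobian_K_def F_def[symmetric] jacobian_ideal_eq[OF convergent2_F] image_image by (intro image_cong refl) auto
qed

text \<open>Vanishing on all earlier branches means divisibility by each earlier f_l, hence by their
  product; this identifies the vanishing part with the image of the intersection that occurs in the
  graded pieces.\<close>

lemma nu_vanishing_part:
  assumes i: "i \<in> {1..r}"
  shows "nu i ` vanishing_part {1..<i} (jacobian_K {1..r} f \<iota>) =
    branch.ord (f i) (\<iota> i) ` (jac \<inter> multiples (low i))"
proof -
  let ?c = "\<lambda>g. incl_K {1..r} f \<iota> (local_class F g)"
  have jc: "convergent2 g" if "g \<in> jac" for g
    using that conv_idealD(1)[OF conv_ideal_tjurina[OF convergent2_F]] by blast
  have iff: "(\<forall>l\<in>{1..<i}. proj l (?c g) = 0) \<longleftrightarrow> g \<in> multiples (low i)" if g: "g \<in> jac" for g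
  proof -
    have "proj l (?c g) = 0 \<longleftrightarrow> g \<in> multiples (f l)" if "l \<in> {1..<i}" for l
    proof -
      have l: "l \<in> {1..r}" using that i by auto
      show ?thesis
        using incl_K_class[OF jc[OF g] l] branch.restr_eq_0_iff[OF branch[OF l] jc[OF g]] by (simp add: proj_def)
    qed
    moreover obtain n where "i = Suc n" using i by (cases i) auto
    ultimately show ?thesis using mem_multiples_low_iff[of n g] i jc[OF g] by auto
  qed
  have vanishing: "vanishing_part {1..<i} (jacobian_K {1..r} f \<iota>) = ?c ` (jac \<inter> multiples (low i))"
    unfolding vanishing_part_def jacobian_K_def F_def[symmetric] jacobian_ideal_eq[OF convergent2_F] image_image
    using iff by blast
  have "nu i (?c g) = branch.ord (f i) (\<iota> i) g" if "g \<in> jac \<inter> multiples (low i)" for g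
    using that incl_K_class[OF jc i] by (simp add: nu_def proj_def)
  then show ?thesis unfolding vanishing image_image by (rule image_cong[OF refl])
qed

end

theorem proposition3p2:
  fixes r :: nat
    and f :: "nat \<Rightarrow> complex fps fps"
    and \<iota> :: "nat \<Rightarrow> complex fps fps set \<Rightarrow> complex fls"
    and \<Delta> :: "nat \<Rightarrow> ereal set"
  assumes "r > 1"
    and "\<And>i. i \<in> {1..r} \<Longrightarrow> f i \<in> carrier CXY"
    and "\<And>i. i \<in> {1..r} \<Longrightarrow> ring_irreducible\<^bsub>CXY\<^esub> (f i)"
    and "\<And>i j. i \<in> {1..r} \<Longrightarrow> j \<in> {1..r} \<Longrightarrow> i \<noteq> j \<Longrightarrow> PIdl\<^bsub>CXY\<^esub> (f i) \<noteq> PIdl\<^bsub>CXY\<^esub> (f j)"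
    and "\<And>i. i \<in> {1..r} \<Longrightarrow> normalization_embedding (f i) (\<iota> i)"
    and "\<And>i. i \<in> {1..r} \<Longrightarrow> \<Delta> i = t_order ` (proj i ` jacobian_K {1..r} f \<iota>)"
  shows "tjurina (\<Prod>i\<in>{1..r}. f i) =
           (\<Sum>i\<in>{1..r}. tjurina (f i))
         + (\<Sum>(i, j) \<in> {(i, j). 1 \<le> i \<and> i < j \<and> j \<le> r}. inter_mult (f i) (f j))
         + (\<Sum>i\<in>{2..r}. ecard (\<Delta> i - nu i ` vanishing_part {1..<i} (jacobian_K {1..r} f \<iota>)))"
proof -
  interpret curve r f \<iota>
    using assms(2-5) by unfold_locales (simp_all add: PIdl_CXY)
  have "\<Delta> i - nu i ` vanishing_part {1..<i} (jacobian_K {1..r} f \<iota>) =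
      branch.ord (f i) (\<iota> i) ` jac - branch.ord (f i) (\<iota> i) ` (jac \<inter> multiples (low i))"
    if "i \<in> {2..r}" for i
    using that assms(6)[of i] t_order_jacobian_K[of i] nu_vanishing_part[of i] by simp
  then show ?thesis using tjurina_F assms(1) by (simp add: F_def)
qed

end
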